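(* Under the standing assumptions below, let $\bar x$ be a stationary point of (P) at which MSCQ holds. Consider: (i) $\bar x$ is a local minimizer of (P); (ii) $\langle z,w\rangle\ge0$ for all $w\in\operatorname{dom}D(\partial f)(\bar x|0)$ and all $z\in D(\partial f)(\bar x|0)(w)$; (iii) for each $w\in\operatorname{dom}D(\partial f)(\bar x|0)$ there exists $z\in D(\partial f)(\bar x|0)(w)$ with $\langle z,w\rangle\ge0$; (iv) for each $w\in\overline K$, $\max\{w^T\nabla^2_xL(\bar x,\lambda)w+w^T\widetilde{\mathcal H}_\lambda w\mid \lambda\in\Lambda(\bar x)\}\ge0$. Then (i) $\Rightarrow$ (ii) $\Leftrightarrow$ (iii) $\Leftrightarrow$ (iv).
   Context: Problem (P): minimize $g(x)$ subject to $q(x)\in\Theta$, where $g:\mathbb{R}^n\to\mathbb{R}$, $q:\mathbb{R}^n\to\mathbb{R}^m$ are $C^2$ and $\Theta\subset\mathbb{R}^m$ is nonempty closed convex; $\Gamma=\{x\mid q(x)\in\Theta\}$, $f=g+\delta_\Gamma$ ($\delta_\Gamma$ the indicator of $\Gamma$), $\bar x\in\Gamma$, $\bar y=q(\bar x)$. $\Theta$ is $C^2$-cone reducible at $\bar y$ to a pointed closed convex cone $C\subset\mathbb{R}^l$: there are a neighborhood $V$ of $\bar y$ and a $C^2$ map $h:V\to\mathbb{R}^l$ with $h(\bar y)=0$, $\nabla h(\bar y)$ surjective, $\Theta\cap V=\{y\in V\mid h(y)\in C\}$. MSCQ at $\bar x$: $d(x;\Gamma)\le\kappa\,d(q(x);\Theta)$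 for all $x$ near $\bar x$, for some $\kappa>0$. $\Lambda(\bar x)=\{\lambda\in N_\Theta(\bar y)\mid \nabla g(\bar x)+\nabla q(\bar x)^T\lambda=0\}$ (convex normal cone), and $\bar x$ is stationary if $\Lambda(\bar x)\ne\emptyset$. $L(x,\lambda)=g(x)+\langle\lambda,q(x)\rangle$. Critical cone $\overline K=T_\Gamma(\bar x)\cap\{\nabla g(\bar x)\}^\perp$. For $\lambda\in\Lambda(\bar x)$, let $\mu_\lambda$ be the unique vector with $\nabla h(\bar y)^T\mu_\lambda=\lambda$ (written $(\nabla h(\bar y)^* )^{-1}(\lambda)$), and $\widetilde{\mathcal H}_\lambda=\nabla q(\bar x)^T\,\nabla^2\langle\mu_\lambda,h(\cdot)\rangle(\bar y)\,\nabla q(\bar x)$. $\partial f$ is the limiting subdifferential, and $D(\partial f)(\bar x|0)(w)=\{z\mid (w,z)\in T_{\operatorname{gph}\partial f}(\bar x,0)\}$ with $T$ the contingent cone $T_\Omega(\bar u)=\{v\mid\exists t_k\downarrow0,v_k\to v,\bar u+t_kv_k\in\Omega\}$. *)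

theory Defs
  imports "HOL-Analysis.Analysis"
begin

definition C2_on :: "'a::euclidean_space set \<Rightarrow> ('a \<Rightarrow> 'b::euclidean_space) \<Rightarrow> bool" where
  "C2_on S F \<longleftrightarrow> open S \<and>
     (\<exists>(F' :: 'a \<Rightarrow> ('a \<Rightarrow>\<^sub>L 'b)) (F'' :: 'a \<Rightarrow> ('a \<Rightarrow>\<^sub>L ('a \<Rightarrow>\<^sub>L 'b))).
        (\<forall>x\<in>S. (F has_derivative blinfun_apply (F' x)) (at x)) \<and>
        (\<forall>x\<in>S. (F' has_derivative blinfun_apply (F'' x)) (at x)) \<and>
        continuous_on S F'')"

definition D1 :: "('a::real_normed_vector \<Rightarrow> 'b::real_normed_vector) \<Rightarrow> 'a \<Rightarrow> 'a \<Rightarrow> 'b" where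
  "D1 F x v = frechet_derivative F (at x) v"

definition D2 :: "('a::real_normed_vector \<Rightarrow> 'b::real_normed_vector) \<Rightarrow> 'a \<Rightarrow> 'a \<Rightarrow> 'a \<Rightarrow> 'b" where
  "D2 F x v w = frechet_derivative (\<lambda>y. D1 F y v) (at x) w"

definition tangent_cone :: "'a::real_normed_vector set \<Rightarrow> 'a \<Rightarrow> 'a set" where
  "tangent_cone \<Omega> u = {v. \<exists>(t :: nat \<Rightarrow> real) vs. (\<forall>k. t k > 0) \<and> t \<longlonglongrightarrow> 0 \<and>
        vs \<longlonglongrightarrow> v \<and> (\<forall>k. u + t k *\<^sub>R vs k \<in> \<Omega>)}"

definition normal_cone_cvx :: "'a::real_inner set \<Rightarrow> 'a \<Rightarrow> 'a set" where
  "normal_cone_cvx \<Theta> y = {lam. \<forall>y'\<in>\<Theta>. lam \<bullet> (y' - y) \<le> 0}"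

definition regular_subdiff :: "('a::real_inner \<Rightarrow> ereal) \<Rightarrow> 'a \<Rightarrow> 'a set" where
  "regular_subdiff f x = {v. \<bar>f x\<bar> \<noteq> \<infinity> \<and>
     (\<forall>\<epsilon>>0. \<exists>\<delta>>0. \<forall>u. dist u x < \<delta> \<longrightarrow>
         f u \<ge> f x + ereal (v \<bullet> (u - x) - \<epsilon> * norm (u - x)))}"

definition limiting_subdiff :: "('a::real_inner \<Rightarrow> ereal) \<Rightarrow> 'a \<Rightarrow> 'a set" where
  "limiting_subdiff f x = {v. \<bar>f x\<bar> \<noteq> \<infinity> \<and>
     (\<exists>xs vs. xs \<longlonglongrightarrow> x \<and> (\<lambda>k. f (xs k)) \<longlonglongrightarrow> f x \<and>
        vs \<longlonglongrightarrow> v \<and> (\<forall>k. vs k \<in> regular_subdiff f (xs k)))}"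

definition graph_of :: "('a \<Rightarrow> 'b set) \<Rightarrow> ('a \<times> 'b) set" where
  "graph_of S = {(x, v). v \<in> S x}"

definition graph_deriv :: "('a::real_normed_vector \<Rightarrow> 'b::real_normed_vector set) \<Rightarrow> 'a \<Rightarrow> 'b \<Rightarrow> 'a \<Rightarrow> 'b set" where
  "graph_deriv S x v w = {z. (w, z) \<in> tangent_cone (graph_of S) (x, v)}"

definition graph_deriv_dom :: "('a::real_normed_vector \<Rightarrow> 'b::real_normed_vector set) \<Rightarrow> 'a \<Rightarrow> 'b \<Rightarrow> 'a set" where
  "graph_deriv_dom S x v = {w. graph_deriv S x v w \<noteq> {}}"

definition fobj :: "('a \<Rightarrow> real) \<Rightarrow> 'a set \<Rightarrow> 'a \<Rightarrow> ereal" where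
  "fobj g \<Gamma> x = (if x \<in> \<Gamma> then ereal (g x) else \<infinity>)"

definition pointed_cone :: "'a::real_vector set \<Rightarrow> bool" where
  "pointed_cone C \<longleftrightarrow> cone C \<and> C \<inter> uminus ` C \<subseteq> {0}"

definition multipliers :: "('a::euclidean_space \<Rightarrow> real) \<Rightarrow> ('a \<Rightarrow> 'b::euclidean_space) \<Rightarrow> 'b set \<Rightarrow> 'a \<Rightarrow> 'b set" where
  "multipliers g q \<Theta> x = {lam \<in> normal_cone_cvx \<Theta> (q x).
      \<forall>w. D1 g x w + lam \<bullet> D1 q x w = 0}"

text \<open>mu_lambda = (nabla h(ybar)^*)^{-1}(lambda).\<close>
definition mu_of :: "('b::euclidean_space \<Rightarrow> 'c::euclidean_space) \<Rightarrow> 'b \<Rightarrow> 'b \<Rightarrow> 'c" where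
  "mu_of h y lam = (THE \<mu>. \<forall>v. \<mu> \<bullet> D1 h y v = lam \<bullet> v)"

end

theory Submission
  imports Defs
begin

text \<open>
  Composing the constraint with the reduction map, \<open>F = h \<circ> q\<close>, turns \<open>\<Gamma>\<close> locally into
  \<open>{x. F x \<in> C}\<close> with \<open>F xbar = 0\<close>, and metric regularity of \<open>h\<close> carries MSCQ over to \<open>F\<close>. Write \<open>M\<close>
  for the multipliers \<open>\<mu>\<close> in the polar of \<open>C\<close> and \<open>Q \<mu> w\<close> for the second-order form.

  By MSCQ, a graph direction \<open>(w, z)\<close> comes with points \<open>x\<^sub>k\<close> and bounded multipliers \<open>\<mu>\<^sub>k\<close>, normal to
  \<open>C\<close> at \<open>F x\<^sub>k\<close>, subconverging to some \<open>\<mu> \<in> M\<close>. Since \<open>C\<close> is a cone, \<open>\<mu>\<^sub>k \<bullet> F x\<^sub>k = 0\<close> and \<open>\<mu>\<^sub>k\<close> is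
  nonpositive on \<open>F'(xbar) w \<in> C\<close>. Testing stationarity with \<open>w\<close> yields \<open>z \<bullet> w \<le> Q \<mu> w\<close>; testing it
  with \<open>x\<^sub>k - xbar\<close> yields \<open>2 (z \<bullet> w) \<ge> Q \<mu> w + Q \<nu> w\<close> for all \<open>\<nu> \<in> M\<close>, and \<open>2 (z \<bullet> w) \<ge> Q \<mu> w\<close> at a
  local minimizer. Hence \<open>z \<bullet> w\<close> is the maximum of \<open>Q \<cdot> w\<close>, and it is nonnegative at a local minimizer.

  It remains to see that the domain of the graphical derivative is dense in the critical cone.
  Minimizing \<open>g + R/2 |\<cdot> - xbar - t w|\<^sup>2\<close> over \<open>\<Gamma>\<close> and letting \<open>t\<close> tend to \<open>0\<close> gives \<open>w'\<close> in the domain with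
  \<open>|w' - w| = O(1 / sqrt R)\<close>; then \<open>R\<close> tends to infinity.
\<close>

section \<open>Second-order expansions\<close>

text \<open>Contingent directions vary with \<open>k\<close>. As \<open>ws\<close> is bounded, a
  remainder that is small relative to \<open>norm (t k *\<^sub>R ws k)\<close> is small relative to
  \<open>t k\<close>.\<close>

lemma has_derivative_tendsto_along:
  fixes f :: "'a::real_normed_vector \<Rightarrow> 'b::real_normed_vector" and t :: "nat \<Rightarrow> real"
  assumes f: "(f has_derivative D) (at x)"
    and t: "\<And>k. t k > 0" "t \<longlonglongrightarrow> 0" and w: "ws \<longlonglongrightarrow> w"
  shows "(\<lambda>k. (1 / t k) *\<^sub>R (f (x + t k *\<^sub>R ws k) - f x)) \<longlonglongrightarrow> D w"
proof -
  interpret D: bounded_linear D using f by (rule has_derivative_bounded_linear)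
  obtain B where B: "\<And>k. norm (ws k) \<le> B" "B > 0"
    using convergent_imp_Bseq[of ws] w unfolding Bseq_def convergent_def by blast
  have lim0: "(\<lambda>k. t k *\<^sub>R ws k) \<longlonglongrightarrow> 0"
    using tendsto_scaleR[OF t(2) w] by simp
  have "(\<lambda>k. (1 / t k) *\<^sub>R (f (x + t k *\<^sub>R ws k) - f x) - D (ws k)) \<longlonglongrightarrow> 0"
  proof (rule tendstoI)
    fix e :: real assume e: "e > 0"
    have "e / (2 * B) > 0" using e B by simp
    then obtain d where d: "d > 0" "\<And>y. norm (y - x) < d \<Longrightarrow>
        norm (f y - f x - D (y - x)) \<le> e / (2 * B) * norm (y - x)"
      using f unfolding has_derivative_at_alt by blast
    have "\<forall>\<^sub>F k in sequentially. norm (t k *\<^sub>R ws k) < d"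
      using tendstoD[OF lim0 d(1)] by (simp add: dist_norm)
    then show "\<forall>\<^sub>F k in sequentially.
        dist ((1 / t k) *\<^sub>R (f (x + t k *\<^sub>R ws k) - f x) - D (ws k)) 0 < e"
    proof eventually_elim
      case (elim k)
      have "(1 / t k) *\<^sub>R (f (x + t k *\<^sub>R ws k) - f x) - D (ws k)
          = (1 / t k) *\<^sub>R (f (x + t k *\<^sub>R ws k) - f x - D (t k *\<^sub>R ws k))"
        using t(1)[of k] by (simp add: D.scaleR scaleR_diff_right)
      also have "norm \<dots> \<le> (1 / t k) * (e / (2 * B) * norm (t k *\<^sub>R ws k))"
        using d(2)[of "x + t k *\<^sub>R ws k"] elim t(1)[of k]
        unfolding norm_scaleR by (intro mult_mono) auto
      also have "\<dots> = e / (2 * B) * norm (ws k)" using t(1)[of k] by simp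
      also have "\<dots> \<le> e / (2 * B) * B"
        using B e by (intro mult_left_mono) auto
      also have "\<dots> < e" using e B by simp
      finally show ?case by simp
    qed
  qed
  from tendsto_add[OF this D.tendsto[OF w]] show ?thesis by simp
qed

text \<open>Differentiability of \<open>F'\<close> at the single point \<open>x0\<close> keeps
  \<open>F'\<close> within \<open>e * norm u\<close> of its affine model on the whole segment; the
  mean value inequality then supplies the second factor \<open>norm u\<close>.\<close>

lemma second_order_remainder:
  fixes F :: "'a::real_normed_vector \<Rightarrow> 'b::real_normed_vector"
    and F' :: "'a \<Rightarrow> 'a \<Rightarrow>\<^sub>L 'b" and F'' :: "'a \<Rightarrow>\<^sub>L 'a \<Rightarrow>\<^sub>L 'b"
  assumes U: "open U" "x0 \<in> U"
    and F: "\<And>x. x \<in> U \<Longrightarrow> (F has_derivative F' x) (at x)"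
    and F': "(F' has_derivative F'') (at x0)" and e: "e > 0"
  obtains d where "d > 0" "\<And>u. norm u < d \<Longrightarrow>
      norm (F (x0 + u) - F x0 - F' x0 u - (1/2) *\<^sub>R F'' u u) \<le> e * (norm u)\<^sup>2"
proof -
  obtain d1 where d1: "d1 > 0" "ball x0 d1 \<subseteq> U"
    using U open_contains_ball by blast
  obtain d2 where d2: "d2 > 0" "\<And>y. norm (y - x0) < d2 \<Longrightarrow>
        norm (F' y - F' x0 - F'' (y - x0)) \<le> e * norm (y - x0)"
    using F' e unfolding has_derivative_at_alt by blast
  show ?thesis
  proof (rule that[of "min d1 d2"])
    fix u :: 'a assume u: "norm u < min d1 d2"
    \<comment> \<open>Subtracting the linear and quadratic terms makes
      \<open>\<phi> 1 - \<phi> 0\<close> exactly the remainder to be bounded.\<close>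
    define \<phi> where "\<phi> s = F (x0 + s *\<^sub>R u) - s *\<^sub>R F' x0 u - (s\<^sup>2 / 2) *\<^sub>R F'' u u" for s :: real
    have der: "(\<phi> has_derivative
          (\<lambda>h. h *\<^sub>R (F' (x0 + s *\<^sub>R u) - F' x0 - F'' (s *\<^sub>R u)) u)) (at s within {0..1})"
      and bnd: "norm (F' (x0 + s *\<^sub>R u) - F' x0 - F'' (s *\<^sub>R u)) \<le> e * norm u"
      if s: "s \<in> {0..1}" for s
    proof -
      have su: "norm (s *\<^sub>R u) \<le> norm u" using s by (simp add: mult_left_le_one_le)
      then have "x0 + s *\<^sub>R u \<in> U" using d1 u by (auto simp: dist_norm)
      then have "(F has_derivative F' (x0 + s *\<^sub>R u)) (at (x0 + s *\<^sub>R u))" by (rule F)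
      then show "(\<phi> has_derivative
          (\<lambda>h. h *\<^sub>R (F' (x0 + s *\<^sub>R u) - F' x0 - F'' (s *\<^sub>R u)) u)) (at s within {0..1})"
        unfolding \<phi>_def
        by (auto intro!: derivative_eq_intros has_derivative_compose[of "\<lambda>s. x0 + s *\<^sub>R u" _ _ _ F]
            simp: blinfun.bilinear_simps algebra_simps)
      have "norm (F' (x0 + s *\<^sub>R u) - F' x0 - F'' (s *\<^sub>R u)) \<le> e * norm (s *\<^sub>R u)"
        using d2(2)[of "x0 + s *\<^sub>R u"] su u by simp
      also have "\<dots> \<le> e * norm u" using su e by (intro mult_left_mono) auto
      finally show "norm (F' (x0 + s *\<^sub>R u) - F' x0 - F'' (s *\<^sub>R u)) \<le> e * norm u" .
    qed
    have "norm (\<phi> 1 - \<phi> 0) \<le> (e * norm u * norm u) * norm (1 - 0 :: real)"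
    proof (rule differentiable_bound[OF _ der])
      fix s :: real assume s: "s \<in> {0..1}"
      show "onorm (\<lambda>h. h *\<^sub>R (F' (x0 + s *\<^sub>R u) - F' x0 - F'' (s *\<^sub>R u)) u) \<le> e * norm u * norm u"
      proof (rule onorm_bound)
        fix h :: real
        have "norm ((F' (x0 + s *\<^sub>R u) - F' x0 - F'' (s *\<^sub>R u)) u) \<le> e * norm u * norm u"
          using norm_blinfun[of "F' (x0 + s *\<^sub>R u) - F' x0 - F'' (s *\<^sub>R u)" u]
            mult_right_mono[OF bnd[OF s], of "norm u"] by simp
        then show "norm (h *\<^sub>R (F' (x0 + s *\<^sub>R u) - F' x0 - F'' (s *\<^sub>R u)) u)
            \<le> e * norm u * norm u * norm h"
          by (simp add: mult.commute mult_left_mono)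
      qed (use e in simp)
    qed auto
    then show "norm (F (x0 + u) - F x0 - F' x0 u - (1/2) *\<^sub>R F'' u u) \<le> e * (norm u)\<^sup>2"
      by (simp add: \<phi>_def power2_eq_square algebra_simps)
  qed (use d1 d2 in auto)
qed

lemma quadratic_bound:
  fixes F :: "'a::real_normed_vector \<Rightarrow> 'b::real_normed_vector"
    and F' :: "'a \<Rightarrow> 'a \<Rightarrow>\<^sub>L 'b" and F'' :: "'a \<Rightarrow>\<^sub>L 'a \<Rightarrow>\<^sub>L 'b"
  assumes U: "open U" "x0 \<in> U"
    and F: "\<And>x. x \<in> U \<Longrightarrow> (F has_derivative F' x) (at x)"
    and F': "(F' has_derivative F'') (at x0)"
  obtains K d where "K \<ge> 0" "d > 0"
    "\<And>u. norm u < d \<Longrightarrow> norm (F (x0 + u) - F x0 - F' x0 u) \<le> K * (norm u)\<^sup>2"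
proof -
  obtain d where d: "d > 0" "\<And>u. norm u < d \<Longrightarrow>
      norm (F (x0 + u) - F x0 - F' x0 u - (1/2) *\<^sub>R F'' u u) \<le> 1 * (norm u)\<^sup>2"
    using second_order_remainder[OF assms zero_less_one] by metis
  show ?thesis
  proof (rule that[of "1 + norm F''" d])
    fix u :: 'a assume u: "norm u < d"
    have "norm (F'' u u) \<le> norm (F'' u) * norm u" by (rule norm_blinfun)
    also have "\<dots> \<le> (norm F'' * norm u) * norm u" by (intro mult_right_mono norm_blinfun) auto
    finally have "norm (F'' u u) \<le> norm F'' * (norm u)\<^sup>2"
      by (simp add: power2_eq_square mult.assoc)
    moreover have "norm ((1/2) *\<^sub>R F'' u u) \<le> norm (F'' u u)" by simp
    ultimately have "norm ((1/2) *\<^sub>R F'' u u) \<le> norm F'' * (norm u)\<^sup>2" by linarith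
    then show "norm (F (x0 + u) - F x0 - F' x0 u) \<le> (1 + norm F'') * (norm u)\<^sup>2"
      using d(2)[OF u] norm_triangle_ineq[of "F (x0 + u) - F x0 - F' x0 u - (1/2) *\<^sub>R F'' u u" "(1/2) *\<^sub>R F'' u u"]
      by (simp add: distrib_right)
  qed (use d in auto)
qed

text \<open>The remainder is of smaller order than
  \<open>(norm (t k *\<^sub>R ws k))\<^sup>2\<close>, hence than \<open>(t k)\<^sup>2\<close>
  because \<open>ws\<close> is bounded; the quadratic term is continuous in the direction.\<close>

lemma second_order_tendsto_along:
  fixes F :: "'a::real_normed_vector \<Rightarrow> 'b::real_normed_vector"
    and F' :: "'a \<Rightarrow> 'a \<Rightarrow>\<^sub>L 'b" and F'' :: "'a \<Rightarrow>\<^sub>L 'a \<Rightarrow>\<^sub>L 'b" and t :: "nat \<Rightarrow> real"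
  assumes U: "open U" "x0 \<in> U"
    and F: "\<And>x. x \<in> U \<Longrightarrow> (F has_derivative F' x) (at x)"
    and F': "(F' has_derivative F'') (at x0)"
    and t: "\<And>k. t k > 0" "t \<longlonglongrightarrow> 0" and w: "ws \<longlonglongrightarrow> w"
  shows "(\<lambda>k. (1 / (t k)\<^sup>2) *\<^sub>R (F (x0 + t k *\<^sub>R ws k) - F x0 - F' x0 (t k *\<^sub>R ws k)))
    \<longlonglongrightarrow> (1/2) *\<^sub>R F'' w w"
proof -
  define R where "R u = F (x0 + u) - F x0 - F' x0 u - (1/2) *\<^sub>R F'' u u" for u
  obtain B where B: "\<And>k. norm (ws k) \<le> B" "B > 0"
    using convergent_imp_Bseq[of ws] w unfolding Bseq_def convergent_def by blast
  have lim0: "(\<lambda>k. t k *\<^sub>R ws k) \<longlonglongrightarrow> 0"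
    using tendsto_scaleR[OF t(2) w] by simp
  have "(\<lambda>k. (1 / (t k)\<^sup>2) *\<^sub>R R (t k *\<^sub>R ws k)) \<longlonglongrightarrow> 0"
  proof (rule tendstoI)
    fix e :: real assume e: "e > 0"
    have "e / (2 * B\<^sup>2) > 0" using e B by simp
    then obtain d where d: "d > 0" "\<And>u. norm u < d \<Longrightarrow> norm (R u) \<le> e / (2 * B\<^sup>2) * (norm u)\<^sup>2"
      using second_order_remainder[OF U F F'] unfolding R_def by metis
    have "\<forall>\<^sub>F k in sequentially. norm (t k *\<^sub>R ws k) < d"
      using tendstoD[OF lim0 d(1)] by (simp add: dist_norm)
    then show "\<forall>\<^sub>F k in sequentially. dist ((1 / (t k)\<^sup>2) *\<^sub>R R (t k *\<^sub>R ws k)) 0 < e"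
    proof eventually_elim
      case (elim k)
      have "norm ((1 / (t k)\<^sup>2) *\<^sub>R R (t k *\<^sub>R ws k))
          \<le> (1 / (t k)\<^sup>2) * (e / (2 * B\<^sup>2) * (norm (t k *\<^sub>R ws k))\<^sup>2)"
        using d(2)[OF elim] unfolding norm_scaleR by (intro mult_mono) (auto simp del: norm_scaleR)
      also have "\<dots> = e / (2 * B\<^sup>2) * (norm (ws k))\<^sup>2"
        using t(1)[of k] by (simp add: power_mult_distrib)
      also have "\<dots> \<le> e / (2 * B\<^sup>2) * B\<^sup>2"
        using B e by (intro mult_left_mono power_mono) auto
      also have "\<dots> < e" using e B by simp
      finally show ?case by simp
    qed
  qed
  moreover have "(\<lambda>k. (1/2) *\<^sub>R F'' (ws k) (ws k)) \<longlonglongrightarrow> (1/2) *\<^sub>R F'' w w"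
    by (intro tendsto_intros w)
  ultimately have "(\<lambda>k. (1 / (t k)\<^sup>2) *\<^sub>R R (t k *\<^sub>R ws k) + (1/2) *\<^sub>R F'' (ws k) (ws k))
      \<longlonglongrightarrow> 0 + (1/2) *\<^sub>R F'' w w" by (rule tendsto_add)
  moreover have "(1 / (t k)\<^sup>2) *\<^sub>R R (t k *\<^sub>R ws k) + (1/2) *\<^sub>R F'' (ws k) (ws k)
      = (1 / (t k)\<^sup>2) *\<^sub>R (F (x0 + t k *\<^sub>R ws k) - F x0 - F' x0 (t k *\<^sub>R ws k))" for k
    using t(1)[of k]
    by (simp add: R_def blinfun.bilinear_simps scaleR_diff_right power2_eq_square)
  ultimately show ?thesis by simp
qed

text \<open>This is the rate at which the directions from \<open>graph_deriv_dense\<close> reach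
  \<open>w\<close> along the penalties \<open>R = R0 + k\<close>.\<close>

lemma sqrt_divide_tendsto_0: "(\<lambda>k. sqrt (c / (d + real k))) \<longlonglongrightarrow> 0"
proof -
  have "filterlim (\<lambda>k. d + real k) at_top sequentially"
    by (rule filterlim_tendsto_add_at_top[OF tendsto_const filterlim_real_sequentially])
  from tendsto_divide_0[OF tendsto_const filterlim_at_top_imp_at_infinity[OF this], of c]
  show ?thesis using tendsto_real_sqrt by fastforce
qed

section \<open>Metric regularity\<close>

text \<open>A Lyusternik-Graves argument: with \<open>B\<close> a right inverse of
  \<open>h' y0\<close>, the equation \<open>h (y + B s) = c\<close> is solved by a simplified Newton
  iteration, which contracts while \<open>h'\<close> stays close to \<open>h' y0\<close>. The base
  point \<open>y\<close> may vary, so the estimate is uniform near \<open>y0\<close>.\<close>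

lemma metric_regular_surj_derivative:
  fixes h :: "'a::euclidean_space \<Rightarrow> 'b::euclidean_space" and h' :: "'a \<Rightarrow> 'a \<Rightarrow>\<^sub>L 'b"
  assumes V: "open V" "y0 \<in> V"
    and h: "\<And>y. y \<in> V \<Longrightarrow> (h has_derivative h' y) (at y)"
    and cont: "continuous (at y0) h'" and surj: "surj (h' y0)"
  obtains a d where "a > 0" "d > 0"
    "\<And>y c. dist y y0 < d \<Longrightarrow> dist c (h y0) < d \<Longrightarrow>
       \<exists>y'\<in>V. h y' = c \<and> norm (y' - y) \<le> a * norm (c - h y)"
proof -
  obtain B where "linear B" "h' y0 \<circ> B = id"
    using linear_surjective_right_inverse[OF _ surj] blinfun.bounded_linear_right
      bounded_linear.linear by blast
  then have lB: "bounded_linear B" and B: "\<And>s. h' y0 (B s) = s"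
    by (auto simp: linear_conv_bounded_linear fun_eq_iff)
  interpret B: bounded_linear B by (rule lB)
  obtain \<beta> where \<beta>: "\<beta> > 0" "\<And>s. norm (B s) \<le> norm s * \<beta>" using B.pos_bounded by blast
  obtain \<eta>1 where \<eta>1: "\<eta>1 > 0" "ball y0 \<eta>1 \<subseteq> V" using V open_contains_ball by blast
  \<comment> \<open>This tolerance makes the contraction factor \<open>1/2\<close>, since
    \<open>B\<close> enlarges norms by at most \<open>\<beta>\<close>.\<close>
  have "1 / (2 * \<beta>) > 0" using \<beta> by simp
  then obtain \<eta>2 where \<eta>2: "\<eta>2 > 0" "\<And>y. dist y y0 < \<eta>2 \<Longrightarrow> dist (h' y) (h' y0) < 1 / (2 * \<beta>)"
    using cont unfolding continuous_at_eps_delta by blast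
  define \<eta> where "\<eta> = min \<eta>1 \<eta>2"
  have \<eta>: "\<eta> > 0" "\<And>y. dist y y0 < \<eta> \<Longrightarrow> y \<in> V" "\<And>y. dist y y0 < \<eta> \<Longrightarrow> norm (h' y - h' y0) \<le> 1 / (2 * \<beta>)"
    using \<eta>1 \<eta>2 less_imp_le by (auto simp: \<eta>_def dist_commute dist_norm subset_eq)
  have "isCont h y0" using has_derivative_continuous[OF h[OF V(2)]] .
  moreover have "\<eta> / (8 * \<beta>) > 0" using \<eta> \<beta> by simp
  ultimately obtain \<eta>3 where \<eta>3: "\<eta>3 > 0" "\<And>y. dist y y0 < \<eta>3 \<Longrightarrow> dist (h y) (h y0) < \<eta> / (8 * \<beta>)"
    unfolding continuous_at_eps_delta by blast
  \<comment> \<open>The bound \<open>\<eta> / (8 * \<beta>)\<close> on both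
    \<open>dist c (h y0)\<close> and \<open>dist (h y) (h y0)\<close> gives
    \<open>r * \<beta> < \<eta> / 2\<close>, so that \<open>y + B s\<close> stays within
    \<open>\<eta>\<close> of \<open>y0\<close> for \<open>norm s \<le> r\<close>.\<close>
  show ?thesis
  proof (rule that[of "2 * \<beta>" "min (min (\<eta> / 2) \<eta>3) (\<eta> / (8 * \<beta>))"])
    fix y c assume y: "dist y y0 < min (min (\<eta> / 2) \<eta>3) (\<eta> / (8 * \<beta>))"
      and c: "dist c (h y0) < min (min (\<eta> / 2) \<eta>3) (\<eta> / (8 * \<beta>))"
    \<comment> \<open>\<open>norm (T 0)\<close> is half of this radius and the contraction factor
      accounts for the other half, so \<open>T\<close> maps the ball into itself. The radius also
      yields the modulus \<open>2 * \<beta>\<close>.\<close>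
    define r where "r = 2 * norm (c - h y)"
    have r0: "r \<ge> 0" by (simp add: r_def)
    have "norm (c - h y) < \<eta> / (4 * \<beta>)"
      using dist_triangle2[of c "h y" "h y0"] \<eta>3(2)[of y] y c by (simp add: dist_norm field_simps)
    then have r: "r * \<beta> < \<eta> / 2" using \<beta> by (simp add: r_def field_simps)
    \<comment> \<open>The fixed points of \<open>T\<close> are exactly the solutions of
      \<open>h (y + B s) = c\<close>.\<close>
    define T where "T s = s - (h (y + B s) - c)" for s :: 'b
    have near: "dist (y + B s) y0 < \<eta>" if "s \<in> cball 0 r" for s :: 'b
    proof -
      have "dist (y + B s) y0 \<le> dist (y + B s) y + dist y y0" by (rule dist_triangle)
      also have "dist (y + B s) y = norm (B s)" by (simp add: dist_norm)
      also have "norm (B s) \<le> r * \<beta>" using \<beta> that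
        by (intro order_trans[OF \<beta>(2)] mult_right_mono) auto
      finally show ?thesis using r y by linarith
    qed
    have lip: "norm (T s - T s') \<le> (1/2) * norm (s - s')" if "s \<in> cball 0 r" "s' \<in> cball 0 r" for s s' :: 'b
    proof (rule differentiable_bound[OF convex_cball _ _ that(1) that(2)])
      fix s :: 'b assume s: "s \<in> cball 0 r"
      have "(h has_derivative h' (y + B s)) (at (y + B s))" using near[OF s] \<eta> h by blast
      then have "(T has_derivative (\<lambda>k. k - h' (y + B s) (B k))) (at s)"
        unfolding T_def
        by (auto intro!: derivative_eq_intros B.has_derivative
            has_derivative_compose[of "\<lambda>s. y + B s" _ _ _ h])
      then show "(T has_derivative (\<lambda>k. k - h' (y + B s) (B k))) (at s within cball 0 r)"
        by (rule has_derivative_at_withinI)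
      show "onorm (\<lambda>k. k - h' (y + B s) (B k)) \<le> 1/2"
      proof (rule onorm_bound)
        fix k
        have "norm (k - h' (y + B s) (B k)) = norm ((h' (y + B s) - h' y0) (B k))"
          by (simp add: blinfun.bilinear_simps B norm_minus_commute)
        also have "\<dots> \<le> norm (h' (y + B s) - h' y0) * norm (B k)" by (rule norm_blinfun)
        also have "\<dots> \<le> (1 / (2 * \<beta>)) * (norm k * \<beta>)"
          using \<eta>(3)[OF near[OF s]] \<beta> by (intro mult_mono) auto
        finally show "norm (k - h' (y + B s) (B k)) \<le> 1/2 * norm k" using \<beta> by simp
      qed simp
    qed
    have "T ` cball 0 r \<subseteq> cball 0 r"
    proof clarsimp
      fix s :: 'b assume s: "norm s \<le> r"
      have "norm (T s - T 0) \<le> (1/2) * r" using lip[of s 0] s r0 by simp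
      moreover have "norm (T 0) = (1/2) * r" by (simp add: T_def r_def B.zero norm_minus_commute)
      ultimately show "norm (T s) \<le> r" using norm_triangle_ineq[of "T s - T 0" "T 0"] by simp
    qed
    then have "\<exists>!s\<in>cball 0 r. T s = s"
      using lip r0 by (intro Banach_fix[where c = "1/2"]) (auto simp: dist_norm complete_eq_closed)
    then obtain s where s: "s \<in> cball 0 r" "T s = s" by blast
    have "norm (B s) \<le> r * \<beta>" using \<beta> s
      by (intro order_trans[OF \<beta>(2)] mult_right_mono) auto
    then show "\<exists>y'\<in>V. h y' = c \<and> norm (y' - y) \<le> 2 * \<beta> * norm (c - h y)"
      using s \<eta>(2)[OF near[OF s(1)]] by (intro bexI[of _ "y + B s"]) (auto simp: T_def r_def mult_ac)
  qed (use \<eta> \<eta>3 \<beta> in auto)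
qed

section \<open>Normal cones and multipliers\<close>

lemma bounded_subsequence:
  fixes f :: "nat \<Rightarrow> 'a::euclidean_space"
  assumes "\<And>n. norm (f n) \<le> B"
  obtains l r where "norm l \<le> B" "strict_mono (r :: nat \<Rightarrow> nat)" "(\<lambda>n. f (r n)) \<longlonglongrightarrow> l"
proof -
  have "\<forall>n. f n \<in> cball 0 B" using assms by simp
  with compact_imp_seq_compact[OF compact_cball] obtain l r
    where "l \<in> cball 0 B" "strict_mono (r :: nat \<Rightarrow> nat)" "(f \<circ> r) \<longlonglongrightarrow> l"
    by (rule seq_compactE)
  then show ?thesis by (intro that[of l r]) (auto simp: comp_def)
qed

lemma normal_cone_cvx_limit:
  assumes "\<And>k. \<mu>s k \<in> normal_cone_cvx C (ys k)" "\<mu>s \<longlonglongrightarrow> \<mu>" "ys \<longlonglongrightarrow> y"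
  shows "\<mu> \<in> normal_cone_cvx C y"
  unfolding normal_cone_cvx_def
proof (intro CollectI ballI)
  fix c assume "c \<in> C"
  then have "\<mu>s k \<bullet> (c - ys k) \<le> 0" for k using assms(1) by (auto simp: normal_cone_cvx_def)
  moreover have "(\<lambda>k. \<mu>s k \<bullet> (c - ys k)) \<longlonglongrightarrow> \<mu> \<bullet> (c - y)"
    by (intro tendsto_intros assms)
  ultimately show "\<mu> \<bullet> (c - y) \<le> 0" by (intro LIMSEQ_le_const2) auto
qed

lemma normal_cone_cvx_scaleR:
  "\<mu> \<in> normal_cone_cvx C y \<Longrightarrow> a \<ge> 0 \<Longrightarrow> a *\<^sub>R \<mu> \<in> normal_cone_cvx C y"
  by (auto simp: normal_cone_cvx_def mult_nonneg_nonpos)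

lemma convex_normal_cone_cvx: "convex (normal_cone_cvx C y)"
  by (auto simp: normal_cone_cvx_def convex_def inner_add_left intro!: add_nonpos_nonpos mult_nonneg_nonpos)

lemma closed_normal_cone_cvx:
  fixes y :: "'a::real_inner" shows "closed (normal_cone_cvx C y)"
  unfolding closed_sequential_limits using normal_cone_cvx_limit[of _ C "\<lambda>_. y"] by auto

text \<open>The projection \<open>c\<close> of \<open>y\<close> and the normalized residual
  \<open>m\<close> make the distance linear in \<open>y - c\<close>. If \<open>y\<close> lies in
  \<open>C\<close>, the residual is zero, whence \<open>norm m \<le> 1\<close> and not
  equality.\<close>

lemma infdist_normal:
  fixes C :: "'a::euclidean_space set"
  assumes C: "convex C" "closed C" "C \<noteq> {}"
  obtains c m where "c \<in> C" "m \<in> normal_cone_cvx C c" "norm m \<le> 1" "dist y c = infdist y C"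
    "infdist y C = m \<bullet> (y - c)"
proof -
  obtain c where c: "c \<in> C" "infdist y C = dist y c"
    using infdist_attains_inf[OF C(2,3)] by blast
  have min: "\<forall>z\<in>C. dist y c \<le> dist y z" using c infdist_le by metis
  have "y - c \<in> normal_cone_cvx C c"
    using any_closest_point_dot[OF C(1,2) c(1) _ min] by (auto simp: normal_cone_cvx_def)
  then have "sgn (y - c) \<in> normal_cone_cvx C c"
    unfolding sgn_div_norm by (intro normal_cone_cvx_scaleR) auto
  moreover have "infdist y C = sgn (y - c) \<bullet> (y - c)"
    by (cases "y = c") (simp_all add: c dist_norm sgn_div_norm dot_square_norm power2_eq_square)
  ultimately show ?thesis using c by (intro that[of c "sgn (y - c)"]) (auto simp: norm_sgn)
qed

text \<open>Exact penalization: on the test point \<open>x + t w\<close> the regular normal inequality costs at most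
  \<open>norm v\<close> times the distance to \<open>\<Gamma>\<close>, which the error bound turns into the distance to \<open>C\<close>.\<close>

lemma normal_direction_bound:
  fixes F :: "'a::euclidean_space \<Rightarrow> 'b::euclidean_space"
  assumes C: "convex C" "closed C" and \<Gamma>: "closed \<Gamma>" "x \<in> \<Gamma>" and Fx: "F x \<in> C"
    and F: "(F has_derivative F') (at x)" and \<kappa>: "\<kappa> \<ge> 0"
    and err: "\<forall>\<^sub>F u in nhds x. infdist u \<Gamma> \<le> \<kappa> * infdist (F u) C"
    and v: "\<And>e. e > 0 \<Longrightarrow> \<exists>d>0. \<forall>u\<in>\<Gamma>. dist u x < d \<longrightarrow> v \<bullet> (u - x) \<le> e * norm (u - x)"
  obtains \<mu> where "\<mu> \<in> normal_cone_cvx C (F x)" "norm \<mu> \<le> 1" "v \<bullet> w \<le> \<kappa> * norm v * (\<mu> \<bullet> F' w)"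
proof -
  define t where "t k = inverse (real (Suc k))" for k
  have t: "t k > 0" "t \<longlonglongrightarrow> 0" for k
    using LIMSEQ_inverse_real_of_nat by (auto simp: t_def[abs_def])
  define u where "u k = x + t k *\<^sub>R w" for k
  have u: "u \<longlonglongrightarrow> x"
    unfolding u_def using tendsto_add[OF tendsto_const tendsto_scaleR[OF t(2) tendsto_const], of x w] by simp
  have Fu: "(\<lambda>k. F (u k)) \<longlonglongrightarrow> F x"
    using u has_derivative_continuous[OF F] by (simp add: isCont_tendsto_compose)
  have "\<exists>c m. c \<in> C \<and> m \<in> normal_cone_cvx C c \<and> norm m \<le> 1 \<and> dist (F (u k)) c = infdist (F (u k)) C \<and>
      infdist (F (u k)) C = m \<bullet> (F (u k) - c)" for k
    using infdist_normal[OF C, of "F (u k)"] Fx by blast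
  then obtain c m where c: "\<And>k. c k \<in> C" "\<And>k. m k \<in> normal_cone_cvx C (c k)" "\<And>k. norm (m k) \<le> 1"
    "\<And>k. dist (F (u k)) (c k) = infdist (F (u k)) C"
    "\<And>k. infdist (F (u k)) C = m k \<bullet> (F (u k) - c k)" by metis
  have "(\<lambda>k. infdist (F (u k)) C) \<longlonglongrightarrow> infdist (F x) C"
    by (intro tendsto_infdist Fu)
  then have "(\<lambda>k. norm (F (u k) - c k)) \<longlonglongrightarrow> 0"
    using Fx unfolding dist_norm[symmetric] c(4) by simp
  then have cl: "c \<longlonglongrightarrow> F x"
    using tendsto_diff[OF Fu tendsto_norm_zero_cancel] by fastforce
  obtain \<mu> r where \<mu>: "norm \<mu> \<le> 1" "strict_mono r" "(\<lambda>k. m (r k)) \<longlonglongrightarrow> \<mu>"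
    using bounded_subsequence[of m 1] c(3) by blast
  have \<mu>N: "\<mu> \<in> normal_cone_cvx C (F x)"
    using normal_cone_cvx_limit[of "\<lambda>k. m (r k)" C "\<lambda>k. c (r k)"] c(2) \<mu>(3)
      LIMSEQ_subseq_LIMSEQ[OF cl \<mu>(2)] by (auto simp: comp_def)
  have dq: "(\<lambda>k. (1 / t (r k)) *\<^sub>R (F (u (r k)) - F x)) \<longlonglongrightarrow> F' w"
    using LIMSEQ_subseq_LIMSEQ[OF has_derivative_tendsto_along[OF F t tendsto_const[of w]] \<mu>(2)]
    by (simp add: comp_def u_def)
  \<comment> \<open>Replacing \<open>c k\<close> by \<open>F x\<close> can only increase the
    product, because \<open>m k\<close> is normal at \<open>c k\<close> and \<open>F x\<close> lies
    in \<open>C\<close>.\<close>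
  have dk: "infdist (F (u k)) C \<le> m k \<bullet> (F (u k) - F x)" for k
    using c(2)[of k] Fx by (auto simp: c(5) normal_cone_cvx_def inner_diff_right)
  have bound: "v \<bullet> w \<le> \<kappa> * norm v * (\<mu> \<bullet> F' w) + e * (2 * norm w)" if e: "e > 0" for e
  proof -
    obtain d where d: "d > 0" "\<And>p. p \<in> \<Gamma> \<Longrightarrow> dist p x < d \<Longrightarrow> v \<bullet> (p - x) \<le> e * norm (p - x)"
      using v[OF e] by blast
    have "d / 2 > 0" using d(1) by simp
    from eventually_conj[OF filterlim_iff[THEN iffD1, OF u, rule_format, OF err] tendstoD[OF u this]]
    have "\<forall>\<^sub>F k in sequentially. v \<bullet> w \<le> norm v * \<kappa> * (m k \<bullet> ((1 / t k) *\<^sub>R (F (u k) - F x))) + e * (2 * norm w)"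
    proof eventually_elim
      case (elim k)
      \<comment> \<open>The test point \<open>u k\<close> is replaced by a nearest feasible point
        \<open>p\<close>, at most twice as far from \<open>x\<close>, so the little-o inequality for
        \<open>v\<close> applies to \<open>p\<close>. The gap between \<open>u k\<close> and
        \<open>p\<close> is paid for by the error bound.\<close>
      obtain p where p: "p \<in> \<Gamma>" "infdist (u k) \<Gamma> = dist (u k) p"
        using infdist_attains_inf[OF \<Gamma>(1)] \<Gamma>(2) by blast
      have "dist (u k) p \<le> dist (u k) x" using p \<Gamma>(2) infdist_le by metis
      then have px: "dist p x \<le> 2 * dist (u k) x" using dist_triangle3[of p x "u k"] by simp
      then have pd: "dist p x < d" using elim by simp
      have "t k * (v \<bullet> w) = v \<bullet> (u k - p) + v \<bullet> (p - x)" by (simp add: u_def algebra_simps)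
      also have "v \<bullet> (u k - p) \<le> norm v * dist (u k) p" by (simp add: dist_norm norm_cauchy_schwarz)
      also have "\<dots> \<le> norm v * (\<kappa> * (m k \<bullet> (F (u k) - F x)))"
        using elim(1) dk[of k] \<kappa> p(2) by (intro mult_left_mono) (auto intro: order_trans[OF _ mult_left_mono])
      also have "v \<bullet> (p - x) \<le> e * norm (p - x)" using d(2)[OF p(1) pd] .
      also have "\<dots> \<le> e * (2 * dist (u k) x)" using px e by (simp add: dist_norm)
      also have "dist (u k) x = t k * norm w" using t(1)[of k] by (simp add: u_def dist_norm)
      finally have "t k * (v \<bullet> w) \<le> t k * (norm v * \<kappa> * (m k \<bullet> ((1 / t k) *\<^sub>R (F (u k) - F x))) + e * (2 * norm w))"
        using t(1)[of k] by (simp add: algebra_simps)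
      then show ?case using t(1)[of k] by simp
    qed
    then have "\<forall>\<^sub>F k in sequentially. v \<bullet> w \<le> norm v * \<kappa> * (m (r k) \<bullet> ((1 / t (r k)) *\<^sub>R (F (u (r k)) - F x))) + e * (2 * norm w)"
      using eventually_subseq[OF \<mu>(2)] by simp
    moreover have "(\<lambda>k. norm v * \<kappa> * (m (r k) \<bullet> ((1 / t (r k)) *\<^sub>R (F (u (r k)) - F x))) + e * (2 * norm w))
       \<longlonglongrightarrow> norm v * \<kappa> * (\<mu> \<bullet> F' w) + e * (2 * norm w)"
      by (intro tendsto_intros \<mu> dq)
    ultimately have "v \<bullet> w \<le> norm v * \<kappa> * (\<mu> \<bullet> F' w) + e * (2 * norm w)"
      by (intro tendsto_lowerbound) auto
    then show ?thesis by (simp add: mult.commute)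
  qed
  have "v \<bullet> w \<le> \<kappa> * norm v * (\<mu> \<bullet> F' w)"
  proof (rule field_le_epsilon)
    fix e :: real assume e: "e > 0"
    \<comment> \<open>The summand \<open>1\<close> keeps the denominator positive when
      \<open>w = 0\<close>.\<close>
    have pos: "2 * norm w + 1 > 0" by (simp add: add_nonneg_pos)
    have "e / (2 * norm w + 1) * (2 * norm w) \<le> e" using e pos by (simp add: field_simps)
    then show "v \<bullet> w \<le> \<kappa> * norm v * (\<mu> \<bullet> F' w) + e"
      using bound[of "e / (2 * norm w + 1)"] e pos by simp
  qed
  with \<mu>N \<mu>(1) show ?thesis by (rule that)
qed

text \<open>The multiplier in \<open>normal_direction_bound\<close> depends on the direction. That
  bound places \<open>v\<close> below the support function of the compact convex set
  \<open>S\<close>; separation turns this into membership in \<open>S\<close>, that is, into one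
  multiplier for all directions.\<close>

lemma regular_normal_multiplier:
  fixes F :: "'a::euclidean_space \<Rightarrow> 'b::euclidean_space"
  assumes C: "convex C" "closed C" and \<Gamma>: "closed \<Gamma>" "x \<in> \<Gamma>" and Fx: "F x \<in> C"
    and F: "(F has_derivative F') (at x)" and \<kappa>: "\<kappa> \<ge> 0"
    and err: "\<forall>\<^sub>F u in nhds x. infdist u \<Gamma> \<le> \<kappa> * infdist (F u) C"
    and v: "\<And>e. e > 0 \<Longrightarrow> \<exists>d>0. \<forall>u\<in>\<Gamma>. dist u x < d \<longrightarrow> v \<bullet> (u - x) \<le> e * norm (u - x)"
  obtains \<mu> where "\<mu> \<in> normal_cone_cvx C (F x)" "norm \<mu> \<le> \<kappa> * norm v" "\<And>w. v \<bullet> w = \<mu> \<bullet> F' w"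
proof -
  have lin: "linear F'" using F has_derivative_linear by blast
  define S where "S = adjoint F' ` (normal_cone_cvx C (F x) \<inter> cball 0 (\<kappa> * norm v))"
  have "compact S"
    unfolding S_def
    by (intro compact_continuous_image linear_continuous_on closed_Int_compact
        closed_normal_cone_cvx compact_cball)
      (simp add: adjoint_linear lin flip: linear_conv_bounded_linear)
  moreover have "convex S"
    unfolding S_def by (intro convex_linear_image adjoint_linear[OF lin] convex_Int convex_normal_cone_cvx convex_cball)
  ultimately have "v \<in> S"
  proof (rule_tac ccontr)
    assume "compact S" "convex S" "v \<notin> S"
    then obtain a b where ab: "a \<bullet> v < b" "\<And>s. s \<in> S \<Longrightarrow> a \<bullet> s > b"
      using separating_hyperplane_closed_point[OF _ compact_imp_closed] by blast
    \<comment> \<open>The separating functional is below \<open>b\<close> at \<open>v\<close> and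
      above \<open>b\<close> on \<open>S\<close>, so the bound is applied in the direction
      \<open>- a\<close>.\<close>
    obtain \<mu> where \<mu>: "\<mu> \<in> normal_cone_cvx C (F x)" "norm \<mu> \<le> 1" "v \<bullet> - a \<le> \<kappa> * norm v * (\<mu> \<bullet> F' (- a))"
      using normal_direction_bound[OF assms] by blast
    have "adjoint F' ((\<kappa> * norm v) *\<^sub>R \<mu>) \<in> S"
      unfolding S_def using \<mu>(1,2) \<kappa>
      by (intro imageI IntI normal_cone_cvx_scaleR) (auto simp: mult_left_le)
    from ab(2)[OF this] have "F' a \<bullet> ((\<kappa> * norm v) *\<^sub>R \<mu>) > b" by (simp add: adjoint_works[OF lin])
    moreover have "v \<bullet> a \<ge> \<kappa> * norm v * (\<mu> \<bullet> F' a)" using \<mu>(3) by (simp add: linear_neg[OF lin])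
    ultimately show False using ab(1) by (simp add: inner_commute)
  qed
  then obtain \<mu> where \<mu>: "\<mu> \<in> normal_cone_cvx C (F x)" "norm \<mu> \<le> \<kappa> * norm v" "v = adjoint F' \<mu>"
    by (auto simp: S_def)
  show ?thesis
    by (rule that[OF \<mu>(1,2)]) (simp add: \<mu>(3) adjoint_works[OF lin] inner_commute[of "adjoint F' \<mu>"] inner_commute)
qed

text \<open>Testing the normal inequality at \<open>0\<close> and at \<open>2 *\<^sub>R y\<close>
  gives complementarity, after which the inequality itself puts \<open>\<mu>\<close> in the polar of
  \<open>C\<close>.\<close>

lemma normal_cone_cvx_cone:
  assumes "cone C" "y \<in> C" "\<mu> \<in> normal_cone_cvx C y"
  shows "\<mu> \<bullet> y = 0" "c \<in> C \<Longrightarrow> \<mu> \<bullet> c \<le> 0"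
proof -
  have *: "\<mu> \<bullet> c \<le> \<mu> \<bullet> y" if "c \<in> C" for c
    using assms(3) that by (auto simp: normal_cone_cvx_def inner_diff_right)
  have sc: "a *\<^sub>R y \<in> C" if "a \<ge> 0" for a using assms(1,2) that unfolding cone_def by blast
  have "0 \<in> C" "2 *\<^sub>R y \<in> C" using sc[of 0] sc[of 2] by simp_all
  then show "\<mu> \<bullet> y = 0" using *[of 0] *[of "2 *\<^sub>R y"] by simp
  then show "c \<in> C \<Longrightarrow> \<mu> \<bullet> c \<le> 0" using * by simp
qed

lemma regular_subdiff_imp_limiting_subdiff:
  assumes "v \<in> regular_subdiff f x" shows "v \<in> limiting_subdiff f x"
  unfolding limiting_subdiff_def
proof (intro CollectI conjI exI allI)
  show "\<bar>f x\<bar> \<noteq> \<infinity>" using assms by (simp add: regular_subdiff_def)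
qed (rule tendsto_const | rule assms)+

section \<open>The reduced problem and multipliers for its subgradients\<close>

text \<open>\<open>F\<close> stands for the composition of \<open>q\<close> with the reduction map
  near \<open>x0\<close>, and \<open>err\<close> for MSCQ carried over to it.\<close>

locale reduced_problem =
  fixes g :: "'a::euclidean_space \<Rightarrow> real" and g' :: "'a \<Rightarrow> 'a \<Rightarrow>\<^sub>L real" and g'' :: "'a \<Rightarrow>\<^sub>L 'a \<Rightarrow>\<^sub>L real"
    and F :: "'a \<Rightarrow> 'c::euclidean_space" and F' :: "'a \<Rightarrow> 'a \<Rightarrow>\<^sub>L 'c" and F'' :: "'a \<Rightarrow>\<^sub>L 'a \<Rightarrow>\<^sub>L 'c"
    and U \<Gamma> :: "'a set" and C :: "'c set" and x0 :: 'a and \<kappa> :: real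
  assumes U: "open U" "x0 \<in> U"
    and g: "\<And>x. x \<in> U \<Longrightarrow> (g has_derivative g' x) (at x)" "(g' has_derivative g'') (at x0)" "continuous_on U g'"
    and F: "\<And>x. x \<in> U \<Longrightarrow> (F has_derivative F' x) (at x)" "(F' has_derivative F'') (at x0)" "continuous_on U F'"
    and C: "closed C" "convex C" "cone C" and Fx0: "F x0 = 0"
    and \<Gamma>: "closed \<Gamma>" "x0 \<in> \<Gamma>" "\<And>x. x \<in> U \<Longrightarrow> x \<in> \<Gamma> \<longleftrightarrow> F x \<in> C"
    and \<kappa>: "\<kappa> \<ge> 0" and err: "\<And>x. x \<in> U \<Longrightarrow> infdist x \<Gamma> \<le> \<kappa> * infdist (F x) C"
begin

text \<open>The Riesz representative of \<open>g' x\<close>: subgradients are vectors, whereas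
  derivatives are bounded linear maps.\<close>

definition grad :: "'a \<Rightarrow> 'a" where "grad x = (\<Sum>b\<in>Basis. g' x b *\<^sub>R b)"

text \<open>As \<open>F x0 = 0\<close>, the normal cone to \<open>C\<close> at \<open>F x0\<close>
  is the polar of \<open>C\<close>, so these are the Lagrange multipliers of the reduced
  problem.\<close>

definition mults :: "'c set" where
  "mults = {\<mu>. (\<forall>c\<in>C. \<mu> \<bullet> c \<le> 0) \<and> (\<forall>w. g' x0 w + \<mu> \<bullet> F' x0 w = 0)}"

text \<open>The second-order form of the reduced Lagrangian at \<open>x0\<close>. The curvature of
  the reduction map is contained in \<open>F''\<close>.\<close>

definition Q :: "'c \<Rightarrow> 'a \<Rightarrow> real" where "Q \<mu> w = g'' w w + \<mu> \<bullet> F'' w w"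

lemma grad: "grad x \<bullet> u = g' x u"
proof -
  have "g' x u = g' x (\<Sum>b\<in>Basis. (u \<bullet> b) *\<^sub>R b)" by (simp add: euclidean_representation)
  also have "\<dots> = grad x \<bullet> u"
    by (simp add: blinfun.sum_right blinfun.scaleR_right grad_def inner_sum_left inner_commute[of u] mult.commute)
  finally show ?thesis by simp
qed

lemma grad_tendsto: "xs \<longlonglongrightarrow> x \<Longrightarrow> x \<in> U \<Longrightarrow> (\<lambda>k. grad (xs k)) \<longlonglongrightarrow> grad x"
  unfolding grad_def
  using g(3) U(1) by (intro tendsto_intros) (auto simp: continuous_on_eq_continuous_at intro: isCont_tendsto_compose)

text \<open>Subtracting the smooth part leaves \<open>v - grad x\<close>, a regular normal to
  \<open>\<Gamma>\<close> at \<open>x\<close>, to which \<open>regular_normal_multiplier\<close>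
  applies.\<close>

lemma regular_subdiff_multiplier:
  assumes v: "v \<in> regular_subdiff (fobj g \<Gamma>) x" and x: "x \<in> U"
  obtains \<mu> where "x \<in> \<Gamma>" "\<mu> \<in> normal_cone_cvx C (F x)" "norm \<mu> \<le> \<kappa> * norm (v - grad x)"
    "\<And>w. v \<bullet> w = g' x w + \<mu> \<bullet> F' x w"
proof -
  have x\<Gamma>: "x \<in> \<Gamma>" using v by (auto simp: regular_subdiff_def fobj_def split: if_splits)
  have "\<exists>d>0. \<forall>u\<in>\<Gamma>. dist u x < d \<longrightarrow> (v - grad x) \<bullet> (u - x) \<le> e * norm (u - x)" if e: "e > 0" for e
  proof -
    have e2: "e / 2 > 0" using e by simp
    obtain d1 where d1: "d1 > 0" "\<forall>u. dist u x < d1 \<longrightarrow>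
         fobj g \<Gamma> u \<ge> fobj g \<Gamma> x + ereal (v \<bullet> (u - x) - e / 2 * norm (u - x))"
      using v e2 unfolding regular_subdiff_def by blast
    obtain d2 where d2: "d2 > 0" "\<forall>u. norm (u - x) < d2 \<longrightarrow>
         norm (g u - g x - g' x (u - x)) \<le> e / 2 * norm (u - x)"
      using g(1)[OF x] e2 unfolding has_derivative_at_alt by blast
    show ?thesis
    proof (intro exI[of _ "min d1 d2"] conjI ballI impI)
      fix u assume u: "u \<in> \<Gamma>" "dist u x < min d1 d2"
      have "g u \<ge> g x + (v \<bullet> (u - x) - e / 2 * norm (u - x))"
        using d1(2)[rule_format, of u] u x\<Gamma> by (simp add: fobj_def)
      moreover have "g u - g x - g' x (u - x) \<le> e / 2 * norm (u - x)"
        using order_trans[OF abs_ge_self d2(2)[rule_format, of u, unfolded real_norm_def]] u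
        by (simp add: dist_norm)
      ultimately show "(v - grad x) \<bullet> (u - x) \<le> e * norm (u - x)"
        by (simp add: inner_diff_left grad)
    qed (use d1 d2 in auto)
  qed
  moreover have "\<forall>\<^sub>F u in nhds x. infdist u \<Gamma> \<le> \<kappa> * infdist (F u) C"
    using eventually_nhds_in_open[OF U(1) x] by eventually_elim (rule err)
  moreover have "F x \<in> C" using \<Gamma>(3)[OF x] x\<Gamma> by simp
  ultimately obtain \<mu> where \<mu>: "\<mu> \<in> normal_cone_cvx C (F x)" "norm \<mu> \<le> \<kappa> * norm (v - grad x)"
    "\<And>w. (v - grad x) \<bullet> w = \<mu> \<bullet> F' x w"
    using regular_normal_multiplier[OF C(2,1) \<Gamma>(1) x\<Gamma> _ F(1)[OF x] \<kappa>, of "v - grad x"] by blast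
  then show ?thesis
    by (intro that[OF x\<Gamma> \<mu>(1,2)]) (simp add: inner_diff_left grad flip: \<mu>(3))
qed

text \<open>The norm bound keeps the multipliers along the defining sequence bounded. A subsequence
  converges, and normality, the bound and the stationarity identity all pass to the limit.\<close>

lemma limiting_subdiff_multiplier:
  assumes v: "v \<in> limiting_subdiff (fobj g \<Gamma>) x" and x: "x \<in> U"
  obtains \<mu> where "x \<in> \<Gamma>" "\<mu> \<in> normal_cone_cvx C (F x)" "norm \<mu> \<le> \<kappa> * norm (v - grad x)"
    "\<And>w. v \<bullet> w = g' x w + \<mu> \<bullet> F' x w"
proof -
  have x\<Gamma>: "x \<in> \<Gamma>" using v by (auto simp: limiting_subdiff_def fobj_def split: if_splits)
  obtain xs0 vs0 where 0: "xs0 \<longlonglongrightarrow> x" "vs0 \<longlonglongrightarrow> v" "\<And>k. vs0 k \<in> regular_subdiff (fobj g \<Gamma>) (xs0 k)"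
    using v unfolding limiting_subdiff_def by blast
  obtain N where N: "\<And>k. k \<ge> N \<Longrightarrow> xs0 k \<in> U"
    using topological_tendstoD[OF 0(1) U(1) x] unfolding eventually_sequentially by blast
  define xs vs where "xs k = xs0 (k + N)" and "vs k = vs0 (k + N)" for k
  have xs: "xs \<longlonglongrightarrow> x" and vs: "vs \<longlonglongrightarrow> v" and xU: "\<And>k. xs k \<in> U"
    using 0 N by (auto simp: xs_def[abs_def] vs_def[abs_def] intro: LIMSEQ_ignore_initial_segment)
  have "\<exists>\<mu>. \<mu> \<in> normal_cone_cvx C (F (xs k)) \<and> norm \<mu> \<le> \<kappa> * norm (vs k - grad (xs k)) \<and>
      (\<forall>w. vs k \<bullet> w = g' (xs k) w + \<mu> \<bullet> F' (xs k) w)" for k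
  proof -
    have "vs k \<in> regular_subdiff (fobj g \<Gamma>) (xs k)" using 0(3) by (simp add: xs_def vs_def)
    from regular_subdiff_multiplier[OF this xU] show ?thesis by blast
  qed
  then obtain \<mu>s where \<mu>s: "\<And>k. \<mu>s k \<in> normal_cone_cvx C (F (xs k))"
    "\<And>k. norm (\<mu>s k) \<le> \<kappa> * norm (vs k - grad (xs k))"
    "\<And>k w. vs k \<bullet> w = g' (xs k) w + \<mu>s k \<bullet> F' (xs k) w" by metis
  have bl: "(\<lambda>k. \<kappa> * norm (vs k - grad (xs k))) \<longlonglongrightarrow> \<kappa> * norm (v - grad x)"
    by (intro tendsto_intros vs grad_tendsto xs x)
  then obtain B where B: "\<And>k. \<bar>\<kappa> * norm (vs k - grad (xs k))\<bar> \<le> B"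
    using convergent_imp_Bseq[OF convergentI[OF bl]] unfolding Bseq_def real_norm_def by blast
  have "norm (\<mu>s k) \<le> B" for k
    using \<mu>s(2)[of k] B[of k] by linarith
  then obtain \<mu> r where \<mu>: "strict_mono r" "(\<lambda>k. \<mu>s (r k)) \<longlonglongrightarrow> \<mu>"
    using bounded_subsequence by metis
  have xr: "(\<lambda>k. xs (r k)) \<longlonglongrightarrow> x" and vr: "(\<lambda>k. vs (r k)) \<longlonglongrightarrow> v"
    and br: "(\<lambda>k. \<kappa> * norm (vs (r k) - grad (xs (r k)))) \<longlonglongrightarrow> \<kappa> * norm (v - grad x)"
    using LIMSEQ_subseq_LIMSEQ[OF xs \<mu>(1)] LIMSEQ_subseq_LIMSEQ[OF vs \<mu>(1)]
      LIMSEQ_subseq_LIMSEQ[OF bl \<mu>(1)] by (auto simp: comp_def)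
  have "isCont F x" "isCont F' x" "isCont g' x"
    using has_derivative_continuous[OF F(1)[OF x]] F(3) g(3) U(1) x
    by (auto simp: continuous_on_eq_continuous_at)
  then have Fr: "(\<lambda>k. F (xs (r k))) \<longlonglongrightarrow> F x" and F'r: "(\<lambda>k. F' (xs (r k))) \<longlonglongrightarrow> F' x"
    and g'r: "(\<lambda>k. g' (xs (r k))) \<longlonglongrightarrow> g' x"
    using xr by (auto intro: isCont_tendsto_compose)
  have "v \<bullet> w = g' x w + \<mu> \<bullet> F' x w" for w
  proof (rule LIMSEQ_unique)
    show "(\<lambda>k. vs (r k) \<bullet> w) \<longlonglongrightarrow> v \<bullet> w" by (intro tendsto_intros vr)
    show "(\<lambda>k. vs (r k) \<bullet> w) \<longlonglongrightarrow> g' x w + \<mu> \<bullet> F' x w"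
      unfolding \<mu>s(3) by (intro tendsto_intros g'r \<mu>(2) F'r)
  qed
  moreover have "norm \<mu> \<le> \<kappa> * norm (v - grad x)"
    using \<mu>s(2) by (intro LIMSEQ_le[OF tendsto_norm[OF \<mu>(2)] br]) auto
  moreover have "\<mu> \<in> normal_cone_cvx C (F x)"
    using \<mu>s(1) by (intro normal_cone_cvx_limit[OF _ \<mu>(2) Fr])
  ultimately show ?thesis using that x\<Gamma> by blast
qed

section \<open>Elements of the graphical derivative\<close>

text \<open>The contingent cone at \<open>(x0, 0)\<close> provides subgradients
  \<open>t k *\<^sub>R zs k\<close> at \<open>x0 + t k *\<^sub>R ws k\<close>. Early terms are
  dropped to enter \<open>U\<close>, and a subsequence makes the multipliers converge. The bound on
  \<open>\<mu>\<close> is independent of \<open>w\<close> and \<open>z\<close>, which later gives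
  compactness when \<open>w\<close> varies.\<close>

lemma graph_deriv_sequences:
  assumes z: "z \<in> graph_deriv (limiting_subdiff (fobj g \<Gamma>)) x0 0 w"
  obtains t ws zs \<mu>s \<mu> where "\<And>k. t k > 0" "t \<longlonglongrightarrow> (0::real)" "ws \<longlonglongrightarrow> w" "zs \<longlonglongrightarrow> z" "\<mu>s \<longlonglongrightarrow> \<mu>"
    "\<And>k. x0 + t k *\<^sub>R ws k \<in> U" "\<And>k::nat. x0 + t k *\<^sub>R ws k \<in> \<Gamma>"
    "\<And>k. \<mu>s k \<in> normal_cone_cvx C (F (x0 + t k *\<^sub>R ws k))"
    "\<And>k u. t k * (zs k \<bullet> u) = g' (x0 + t k *\<^sub>R ws k) u + \<mu>s k \<bullet> F' (x0 + t k *\<^sub>R ws k) u"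
    "norm \<mu> \<le> \<kappa> * norm (grad x0)"
proof -
  obtain t0 vs where 0: "\<And>k. t0 k > 0" "t0 \<longlonglongrightarrow> (0::real)" "vs \<longlonglongrightarrow> (w, z)"
    "\<And>k::nat. (x0, 0) + t0 k *\<^sub>R vs k \<in> graph_of (limiting_subdiff (fobj g \<Gamma>))"
    using z unfolding graph_deriv_def tangent_cone_def by blast
  have w0: "(\<lambda>k. fst (vs k)) \<longlonglongrightarrow> w" and z0: "(\<lambda>k. snd (vs k)) \<longlonglongrightarrow> z"
    using tendsto_fst[OF 0(3)] tendsto_snd[OF 0(3)] by simp_all
  have sub0: "t0 k *\<^sub>R snd (vs k) \<in> limiting_subdiff (fobj g \<Gamma>) (x0 + t0 k *\<^sub>R fst (vs k))" for k
    using 0(4)[of k] by (cases "vs k") (simp add: graph_of_def)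
  have "(\<lambda>k. x0 + t0 k *\<^sub>R fst (vs k)) \<longlonglongrightarrow> x0 + 0 *\<^sub>R w"
    by (intro tendsto_intros 0(2) w0)
  from topological_tendstoD[OF this U(1)] U(2) obtain N where
    N: "\<And>k. k \<ge> N \<Longrightarrow> x0 + t0 k *\<^sub>R fst (vs k) \<in> U"
    unfolding eventually_sequentially by auto
  define t1 w1 z1 where "t1 k = t0 (k + N)" and "w1 k = fst (vs (k + N))" and "z1 k = snd (vs (k + N))" for k
  have t1: "\<And>k. t1 k > 0" "t1 \<longlonglongrightarrow> 0" and w1: "w1 \<longlonglongrightarrow> w" and z1: "z1 \<longlonglongrightarrow> z"
    using 0(1) LIMSEQ_ignore_initial_segment[OF 0(2), of N] LIMSEQ_ignore_initial_segment[OF w0, of N]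
      LIMSEQ_ignore_initial_segment[OF z0, of N]
    by (simp_all add: t1_def[abs_def] w1_def[abs_def] z1_def[abs_def])
  define x1 where "x1 k = x0 + t1 k *\<^sub>R w1 k" for k
  have x1U: "x1 k \<in> U" and sub1: "t1 k *\<^sub>R z1 k \<in> limiting_subdiff (fobj g \<Gamma>) (x1 k)" for k
    using N[of "k + N"] sub0[of "k + N"] by (simp_all add: x1_def t1_def w1_def z1_def)
  have "\<exists>\<mu>. x1 k \<in> \<Gamma> \<and> \<mu> \<in> normal_cone_cvx C (F (x1 k)) \<and> norm \<mu> \<le> \<kappa> * norm (t1 k *\<^sub>R z1 k - grad (x1 k)) \<and>
      (\<forall>u. t1 k *\<^sub>R z1 k \<bullet> u = g' (x1 k) u + \<mu> \<bullet> F' (x1 k) u)" for k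
    using limiting_subdiff_multiplier[OF sub1 x1U] by blast
  then obtain m where m: "\<And>k. x1 k \<in> \<Gamma>" "\<And>k. m k \<in> normal_cone_cvx C (F (x1 k))"
    "\<And>k. norm (m k) \<le> \<kappa> * norm (t1 k *\<^sub>R z1 k - grad (x1 k))"
    "\<And>k u. t1 k *\<^sub>R z1 k \<bullet> u = g' (x1 k) u + m k \<bullet> F' (x1 k) u" by metis
  have "(\<lambda>k. x1 k) \<longlonglongrightarrow> x0 + 0 *\<^sub>R w" unfolding x1_def by (intro tendsto_intros t1 w1)
  then have x1: "x1 \<longlonglongrightarrow> x0" by simp
  have "(\<lambda>k. \<kappa> * norm (t1 k *\<^sub>R z1 k - grad (x1 k))) \<longlonglongrightarrow> \<kappa> * norm (0 *\<^sub>R z - grad x0)"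
    by (intro tendsto_intros t1 z1 grad_tendsto x1 U)
  then have bl: "(\<lambda>k. \<kappa> * norm (t1 k *\<^sub>R z1 k - grad (x1 k))) \<longlonglongrightarrow> \<kappa> * norm (grad x0)" by simp
  obtain B where B: "\<And>k. \<bar>\<kappa> * norm (t1 k *\<^sub>R z1 k - grad (x1 k))\<bar> \<le> B"
    using convergent_imp_Bseq[OF convergentI[OF bl]] unfolding Bseq_def real_norm_def by blast
  have "norm (m k) \<le> B" for k using m(3)[of k] B[of k] by linarith
  then obtain \<mu> r where \<mu>: "strict_mono r" "(\<lambda>k. m (r k)) \<longlonglongrightarrow> \<mu>"
    using bounded_subsequence by metis
  have "norm \<mu> \<le> \<kappa> * norm (grad x0)"
    using m(3) LIMSEQ_subseq_LIMSEQ[OF bl \<mu>(1)]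
    by (intro LIMSEQ_le[OF tendsto_norm[OF \<mu>(2)]]) (auto simp: comp_def)
  then show ?thesis
    using t1 m x1U \<mu> LIMSEQ_subseq_LIMSEQ[OF t1(2) \<mu>(1)] LIMSEQ_subseq_LIMSEQ[OF w1 \<mu>(1)]
      LIMSEQ_subseq_LIMSEQ[OF z1 \<mu>(1)]
    by (intro that[of "t1 \<circ> r" "w1 \<circ> r" "z1 \<circ> r" "m \<circ> r" \<mu>]) (auto simp: comp_def x1_def)
qed

text \<open>The identity of \<open>graph_deriv_sequences\<close> is tested with \<open>w\<close>,
  where \<open>\<mu>s k \<bullet> F' x0 w\<close> has a sign, and with \<open>ws k\<close>, where
  complementarity trades \<open>\<mu>s k \<bullet> F' x0 (ws k)\<close> for the second-order term of
  \<open>F\<close>.\<close>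

lemma graph_deriv_multiplier:
  assumes z: "z \<in> graph_deriv (limiting_subdiff (fobj g \<Gamma>)) x0 0 w"
  obtains \<mu> where "\<mu> \<in> mults" "norm \<mu> \<le> \<kappa> * norm (grad x0)" "w \<in> tangent_cone \<Gamma> x0" "g' x0 w = 0"
    "z \<bullet> w \<le> Q \<mu> w" "\<And>\<nu>. \<nu> \<in> mults \<Longrightarrow> Q \<mu> w + Q \<nu> w \<le> 2 * (z \<bullet> w)"
    "\<And>d. d > 0 \<Longrightarrow> \<forall>x\<in>\<Gamma>. dist x x0 < d \<longrightarrow> g x0 \<le> g x \<Longrightarrow> Q \<mu> w \<le> 2 * (z \<bullet> w)"
proof -
  obtain t ws zs \<mu>s \<mu> where t: "\<And>k. t k > 0" "t \<longlonglongrightarrow> (0::real)" and ws: "ws \<longlonglongrightarrow> w" and zs: "zs \<longlonglongrightarrow> z"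
    and \<mu>s: "\<mu>s \<longlonglongrightarrow> \<mu>" and xU': "\<And>k. x0 + t k *\<^sub>R ws k \<in> U" and x\<Gamma>': "\<And>k::nat. x0 + t k *\<^sub>R ws k \<in> \<Gamma>"
    and \<mu>N': "\<And>k. \<mu>s k \<in> normal_cone_cvx C (F (x0 + t k *\<^sub>R ws k))"
    and eq': "\<And>k u. t k * (zs k \<bullet> u) = g' (x0 + t k *\<^sub>R ws k) u + \<mu>s k \<bullet> F' (x0 + t k *\<^sub>R ws k) u"
    and \<mu>b: "norm \<mu> \<le> \<kappa> * norm (grad x0)"
    using graph_deriv_sequences[OF z] by blast
  define x where "x k = x0 + t k *\<^sub>R ws k" for k
  note xU = xU'[folded x_def] and x\<Gamma> = x\<Gamma>'[folded x_def] and \<mu>N = \<mu>N'[folded x_def] and eq = eq'[folded x_def]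
  have t0: "t k \<noteq> 0" for k using t(1)[of k] by simp
  have "x \<longlonglongrightarrow> x0 + 0 *\<^sub>R w" unfolding x_def by (intro tendsto_intros t ws)
  then have xl: "x \<longlonglongrightarrow> x0" by simp
  have FC: "F (x k) \<in> C" for k using \<Gamma>(3)[OF xU] x\<Gamma> by simp
  have comp: "\<mu>s k \<bullet> F (x k) = 0" and pol: "\<And>c. c \<in> C \<Longrightarrow> \<mu>s k \<bullet> c \<le> 0" for k
    using normal_cone_cvx_cone[OF C(3) FC \<mu>N] by auto
  define DF Dg where "DF k = (1 / t k) *\<^sub>R (F' (x k) - F' x0)" and "Dg k = (1 / t k) *\<^sub>R (g' (x k) - g' x0)" for k
  have DF: "DF \<longlonglongrightarrow> F'' w" and Dg: "Dg \<longlonglongrightarrow> g'' w"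
    unfolding DF_def Dg_def x_def
    using has_derivative_tendsto_along[OF F(2) t ws] has_derivative_tendsto_along[OF g(2) t ws] by simp_all
  define EF Eg where "EF k = (1 / (t k)\<^sup>2) *\<^sub>R (F (x k) - t k *\<^sub>R F' x0 (ws k))"
    and "Eg k = (1 / (t k)\<^sup>2) * (g (x k) - g x0 - t k * g' x0 (ws k))" for k
  have EF: "EF \<longlonglongrightarrow> (1/2) *\<^sub>R F'' w w" and Eg: "Eg \<longlonglongrightarrow> (1/2) * g'' w w"
    unfolding EF_def Eg_def x_def
    using second_order_tendsto_along[OF U F(1,2) t ws] second_order_tendsto_along[OF U g(1,2) t ws]
    by (simp_all add: Fx0 blinfun.scaleR_right)
  have F1: "(\<lambda>k. (1 / t k) *\<^sub>R F (x k)) \<longlonglongrightarrow> F' x0 w"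
    using has_derivative_tendsto_along[OF F(1)[OF U(2)] t ws] by (simp add: Fx0 x_def)
  have AC: "F' x0 w \<in> C"
  proof (rule closed_sequentially[OF C(1) _ F1])
    show "(1 / t k) *\<^sub>R F (x k) \<in> C" for k using C(3) FC t(1)[of k] unfolding cone_def by simp
  qed
  have \<mu>A: "\<mu> \<bullet> F' x0 w = 0"
  proof (rule LIMSEQ_unique)
    show "(\<lambda>k. \<mu>s k \<bullet> (1 / t k) *\<^sub>R F (x k)) \<longlonglongrightarrow> \<mu> \<bullet> F' x0 w" by (intro tendsto_intros \<mu>s F1)
    show "(\<lambda>k. \<mu>s k \<bullet> (1 / t k) *\<^sub>R F (x k)) \<longlonglongrightarrow> 0" by (simp add: comp)
  qed
  have \<mu>st: "g' x0 u + \<mu> \<bullet> F' x0 u = 0" for u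
  proof (rule LIMSEQ_unique)
    have "isCont F' x0" "isCont g' x0" using F(3) g(3) U by (auto simp: continuous_on_eq_continuous_at)
    then have "(\<lambda>k. F' (x k)) \<longlonglongrightarrow> F' x0" "(\<lambda>k. g' (x k)) \<longlonglongrightarrow> g' x0"
      using xl by (auto intro: isCont_tendsto_compose)
    then show "(\<lambda>k. g' (x k) u + \<mu>s k \<bullet> F' (x k) u) \<longlonglongrightarrow> g' x0 u + \<mu> \<bullet> F' x0 u"
      by (intro tendsto_intros \<mu>s)
    have "(\<lambda>k. t k * (zs k \<bullet> u)) \<longlonglongrightarrow> 0 * (z \<bullet> u)" by (intro tendsto_intros t zs)
    then show "(\<lambda>k. g' (x k) u + \<mu>s k \<bullet> F' (x k) u) \<longlonglongrightarrow> 0" by (simp add: eq)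
  qed
  have "\<mu> \<bullet> c \<le> 0" if "c \<in> C" for c
    using pol[OF that] by (intro LIMSEQ_le_const2[OF tendsto_inner[OF \<mu>s tendsto_const]]) auto
  then have \<mu>M: "\<mu> \<in> mults" using \<mu>st by (simp add: mults_def)
  have g0: "g' x0 w = 0" using \<mu>st[of w] \<mu>A by simp
  have upper: "z \<bullet> w \<le> Q \<mu> w"
    unfolding Q_def
  proof (rule LIMSEQ_le)
    show "(\<lambda>k. zs k \<bullet> w) \<longlonglongrightarrow> z \<bullet> w" by (intro tendsto_intros zs)
    show "(\<lambda>k. Dg k w + \<mu>s k \<bullet> DF k w) \<longlonglongrightarrow> g'' w w + \<mu> \<bullet> F'' w w" by (intro tendsto_intros Dg \<mu>s DF)
    have "zs k \<bullet> w \<le> Dg k w + \<mu>s k \<bullet> DF k w" for k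
    proof -
      \<comment> \<open>After multiplication by \<open>t k\<close> the only leftover is
        \<open>\<mu>s k \<bullet> F' x0 w\<close>, nonpositive because \<open>F' x0 w\<close> lies
        in \<open>C\<close>; the leftover of \<open>g\<close> vanishes by \<open>g0\<close>.\<close>
      have "t k * (Dg k w + \<mu>s k \<bullet> DF k w) = t k * (zs k \<bullet> w) - \<mu>s k \<bullet> F' x0 w"
        using t0[of k] by (simp add: Dg_def DF_def blinfun.bilinear_simps g0 eq algebra_simps)
      then have "t k * (zs k \<bullet> w) \<le> t k * (Dg k w + \<mu>s k \<bullet> DF k w)" using pol[OF AC, of k] by simp
      then show ?thesis using t(1)[of k] by simp
    qed
    then show "\<exists>N. \<forall>k\<ge>N. zs k \<bullet> w \<le> Dg k w + \<mu>s k \<bullet> DF k w" by blast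
  qed
  \<comment> \<open>The linear term of \<open>g\<close> at the scale \<open>(t k)\<^sup>2\<close>.
    Stationarity determines its limit, while other multipliers and local minimality each bound it
    from below.\<close>
  define p where "p k = (1 / t k) * g' x0 (ws k)" for k
  have "(\<lambda>k. zs k \<bullet> ws k - (Dg k (ws k) + \<mu>s k \<bullet> DF k (ws k) - \<mu>s k \<bullet> EF k))
     \<longlonglongrightarrow> z \<bullet> w - (g'' w w + \<mu> \<bullet> F'' w w - \<mu> \<bullet> (1/2) *\<^sub>R F'' w w)"
    by (intro tendsto_intros zs ws Dg \<mu>s DF EF)
  moreover have "zs k \<bullet> ws k - (Dg k (ws k) + \<mu>s k \<bullet> DF k (ws k) - \<mu>s k \<bullet> EF k) = p k" for k
  proof -
    have "t k * (Dg k (ws k) + \<mu>s k \<bullet> DF k (ws k) - \<mu>s k \<bullet> EF k) = t k * (zs k \<bullet> ws k) - t k * p k"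
      using t0[of k] eq[of k "ws k"]
      by (simp add: Dg_def DF_def EF_def p_def blinfun.bilinear_simps inner_diff_right comp power2_eq_square algebra_simps)
    then have "t k * (zs k \<bullet> ws k - (Dg k (ws k) + \<mu>s k \<bullet> DF k (ws k) - \<mu>s k \<bullet> EF k)) = t k * p k"
      by (simp add: algebra_simps)
    then show ?thesis using t0[of k] by simp
  qed
  ultimately have p: "p \<longlonglongrightarrow> z \<bullet> w - (g'' w w + (1/2) * (\<mu> \<bullet> F'' w w))" by (simp add: add.commute)
  show ?thesis
  proof (rule that[OF \<mu>M \<mu>b _ g0 upper])
    show "w \<in> tangent_cone \<Gamma> x0"
      unfolding tangent_cone_def using t ws x\<Gamma> unfolding x_def by blast
  next
    fix \<nu> assume \<nu>: "\<nu> \<in> mults"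
    have "\<nu> \<bullet> (1/2) *\<^sub>R F'' w w \<le> z \<bullet> w - (g'' w w + (1/2) * (\<mu> \<bullet> F'' w w))"
    proof (rule LIMSEQ_le[OF _ p])
      show "(\<lambda>k. \<nu> \<bullet> EF k) \<longlonglongrightarrow> \<nu> \<bullet> (1/2) *\<^sub>R F'' w w" by (intro tendsto_intros EF)
      have "\<nu> \<bullet> EF k \<le> p k" for k
      proof -
        \<comment> \<open>Stationarity for \<open>\<nu>\<close> trades the linear term of
          \<open>g\<close> for that of \<open>F\<close>; the difference between
          \<open>\<nu> \<bullet> EF k\<close> and \<open>p k\<close> is then the nonpositive
          \<open>\<nu> \<bullet> F (x k)\<close>, rescaled.\<close>
        have "g' x0 (ws k) = - (\<nu> \<bullet> F' x0 (ws k))" "\<nu> \<bullet> F (x k) \<le> 0"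
          using \<nu> FC[of k] unfolding mults_def by (auto simp: eq_neg_iff_add_eq_0)
        moreover have "\<nu> \<bullet> EF k = (1 / (t k)\<^sup>2) * (\<nu> \<bullet> F (x k)) - (1 / t k) * (\<nu> \<bullet> F' x0 (ws k))"
          using t0[of k] by (simp add: EF_def inner_diff_right power2_eq_square diff_divide_distrib)
        ultimately show ?thesis using t(1)[of k] by (simp add: p_def divide_nonpos_pos)
      qed
      then show "\<exists>N. \<forall>k\<ge>N. \<nu> \<bullet> EF k \<le> p k" by blast
    qed
    then show "Q \<mu> w + Q \<nu> w \<le> 2 * (z \<bullet> w)" by (simp add: Q_def)
  next
    fix d :: real assume d: "d > 0" "\<forall>x\<in>\<Gamma>. dist x x0 < d \<longrightarrow> g x0 \<le> g x"
    have "- (z \<bullet> w - (g'' w w + (1/2) * (\<mu> \<bullet> F'' w w))) \<le> (1/2) * g'' w w"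
    proof (rule tendsto_le[OF _ Eg tendsto_minus[OF p]])
      show "\<forall>\<^sub>F k in sequentially. - p k \<le> Eg k"
        using tendstoD[OF xl d(1)]
      proof eventually_elim
        case (elim k)
        then have "g x0 \<le> g (x k)" using d(2) x\<Gamma> by blast
        moreover have "Eg k = (1 / (t k)\<^sup>2) * (g (x k) - g x0) - p k"
          using t0[of k] by (simp add: Eg_def p_def power2_eq_square diff_divide_distrib)
        ultimately show ?case by simp
      qed
    qed simp
    then show "Q \<mu> w \<le> 2 * (z \<bullet> w)" by (simp add: Q_def)
  qed
qed

section \<open>Density of the domain in the critical cone\<close>

text \<open>As \<open>F x0 = 0\<close> and \<open>C\<close> is a cone, the difference quotients of
  \<open>F\<close> at feasible points lie in \<open>C\<close>, which is closed.\<close>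

lemma tangent_cone_linearized:
  assumes "w \<in> tangent_cone \<Gamma> x0" shows "F' x0 w \<in> C"
proof -
  obtain t ws where t: "\<And>k. t k > 0" "t \<longlonglongrightarrow> (0::real)" and ws: "ws \<longlonglongrightarrow> w"
    and x\<Gamma>: "\<And>k::nat. x0 + t k *\<^sub>R ws k \<in> \<Gamma>"
    using assms unfolding tangent_cone_def by blast
  have "(\<lambda>k. x0 + t k *\<^sub>R ws k) \<longlonglongrightarrow> x0 + 0 *\<^sub>R w" by (intro tendsto_intros t ws)
  then have "(\<lambda>k. x0 + t k *\<^sub>R ws k) \<longlonglongrightarrow> x0" by simp
  from topological_tendstoD[OF this U]
  have ev: "\<forall>\<^sub>F k in sequentially. (1 / t k) *\<^sub>R F (x0 + t k *\<^sub>R ws k) \<in> C"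
  proof eventually_elim
    case (elim k)
    then show ?case using \<Gamma>(3)[OF elim] x\<Gamma> C(3) t(1)[of k] unfolding cone_def by simp
  qed
  have F1: "(\<lambda>k. (1 / t k) *\<^sub>R F (x0 + t k *\<^sub>R ws k)) \<longlonglongrightarrow> F' x0 w"
    using has_derivative_tendsto_along[OF F(1)[OF U(2)] t ws] by (simp add: Fx0)
  show ?thesis using Lim_in_closed_set[OF C(1) ev _ F1] by simp
qed

text \<open>Expanding the square about \<open>x\<close> turns minimality of the penalized objective
  into a subgradient inequality with a quadratic error.\<close>

lemma regular_subdiff_proximal:
  assumes x: "x \<in> \<Gamma>" "x \<in> ball x0 \<rho>" and R: "R > 0"
    and min: "\<And>u. u \<in> \<Gamma> \<Longrightarrow> u \<in> cball x0 \<rho> \<Longrightarrow>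
       g x + R / 2 * (norm (x - p))\<^sup>2 \<le> g u + R / 2 * (norm (u - p))\<^sup>2"
  shows "R *\<^sub>R (p - x) \<in> regular_subdiff (fobj g \<Gamma>) x"
  unfolding regular_subdiff_def
proof (intro CollectI conjI allI impI)
  show "\<bar>fobj g \<Gamma> x\<bar> \<noteq> \<infinity>" using x by (simp add: fobj_def)
next
  fix e :: real assume e: "e > 0"
  have "\<rho> - dist x x0 > 0" using x(2) by (simp add: dist_commute)
  then show "\<exists>d>0. \<forall>u. dist u x < d \<longrightarrow>
      fobj g \<Gamma> u \<ge> fobj g \<Gamma> x + ereal ((R *\<^sub>R (p - x)) \<bullet> (u - x) - e * norm (u - x))"
  \<comment> \<open>The first radius keeps \<open>u\<close> in the ball where \<open>x\<close> is
    minimal; the second absorbs the quadratic error into \<open>e * norm (u - x)\<close>.\<close>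
  proof (intro exI[of _ "min (\<rho> - dist x x0) (2 * e / R)"] conjI allI impI)
    fix u assume u: "dist u x < min (\<rho> - dist x x0) (2 * e / R)"
    show "fobj g \<Gamma> u \<ge> fobj g \<Gamma> x + ereal ((R *\<^sub>R (p - x)) \<bullet> (u - x) - e * norm (u - x))"
    proof (cases "u \<in> \<Gamma>")
      case True
      have "dist u x0 \<le> \<rho>" using u dist_triangle[of u x0 x] by simp
      then have "g x + R / 2 * (norm (x - p))\<^sup>2 \<le> g u + R / 2 * (norm (u - p))\<^sup>2"
        by (intro min[OF True]) (simp add: dist_commute)
      moreover have "(norm (u - p))\<^sup>2 = (norm (x - p))\<^sup>2 - 2 * ((p - x) \<bullet> (u - x)) + (norm (u - x))\<^sup>2"
        by (simp add: power2_norm_eq_inner inner_diff_left inner_diff_right inner_commute algebra_simps)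
      moreover have "R / 2 * (norm (u - x))\<^sup>2 \<le> e * norm (u - x)"
      proof -
        have "R / 2 * norm (u - x) \<le> e" using u R by (simp add: dist_norm field_simps)
        from mult_right_mono[OF this norm_ge_zero[of "u - x"]] show ?thesis
          by (simp add: power2_eq_square mult.assoc)
      qed
      ultimately have "g u \<ge> g x + (R * ((p - x) \<bullet> (u - x)) - e * norm (u - x))"
        by (simp add: algebra_simps)
      then show ?thesis using True x by (simp add: fobj_def)
    qed (simp add: fobj_def)
  qed (use e R in simp)
qed

text \<open>A multiplier replaces the linear term of \<open>g\<close> by
  \<open>- (\<nu> \<bullet> F' x0 (x - x0))\<close>. On \<open>\<Gamma>\<close> one has
  \<open>\<nu> \<bullet> F x \<le> 0\<close>, so this term is bounded below by the Taylor remainder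
  of \<open>F\<close>. The bound keeps penalized minimizers close to their target.\<close>

lemma quadratic_minorant:
  assumes "\<nu> \<in> mults"
  obtains K d where "K \<ge> 0" "d > 0"
    "\<And>x. x \<in> \<Gamma> \<Longrightarrow> norm (x - x0) < d \<Longrightarrow> g x \<ge> g x0 - K * (norm (x - x0))\<^sup>2"
proof -
  obtain Kg dg where Kg: "Kg \<ge> 0" "dg > 0"
    "\<And>u. norm u < dg \<Longrightarrow> norm (g (x0 + u) - g x0 - g' x0 u) \<le> Kg * (norm u)\<^sup>2"
    using quadratic_bound[OF U g(1,2)] by blast
  obtain KF dF where KF: "KF \<ge> 0" "dF > 0"
    "\<And>u. norm u < dF \<Longrightarrow> norm (F (x0 + u) - F x0 - F' x0 u) \<le> KF * (norm u)\<^sup>2"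
    using quadratic_bound[OF U F(1,2)] by blast
  obtain e where e: "e > 0" "ball x0 e \<subseteq> U" using U open_contains_ball by blast
  show ?thesis
  proof (rule that[of "Kg + norm \<nu> * KF" "min (min dg dF) e"])
    fix x assume x: "x \<in> \<Gamma>" "norm (x - x0) < min (min dg dF) e"
    have "x \<in> U" using e x by (auto simp: dist_norm norm_minus_commute)
    then have FC: "F x \<in> C" using x \<Gamma>(3) by simp
    have "g' x0 (x - x0) = - (\<nu> \<bullet> F' x0 (x - x0))" "\<nu> \<bullet> F x \<le> 0"
      using assms FC unfolding mults_def by (auto simp: eq_neg_iff_add_eq_0)
    then have "g' x0 (x - x0) \<ge> \<nu> \<bullet> (F x - F' x0 (x - x0))" by (simp add: inner_diff_right)
    moreover have "\<bar>\<nu> \<bullet> (F x - F' x0 (x - x0))\<bar> \<le> norm \<nu> * (KF * (norm (x - x0))\<^sup>2)"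
      using KF(3)[of "x - x0"] x
      by (intro order_trans[OF Cauchy_Schwarz_ineq2] mult_left_mono) (auto simp: Fx0)
    moreover have "\<bar>g x - g x0 - g' x0 (x - x0)\<bar> \<le> Kg * (norm (x - x0))\<^sup>2"
      using Kg(3)[of "x - x0"] x by simp
    ultimately show "g x \<ge> g x0 - (Kg + norm \<nu> * KF) * (norm (x - x0))\<^sup>2"
      by (simp add: algebra_simps)
  qed (use Kg KF e in auto)
qed

text \<open>The linearization puts \<open>F (x0 + t w)\<close> within order \<open>t\<^sup>2\<close>
  of the point \<open>t F' x0 w\<close> of \<open>C\<close>, so the error bound supplies a feasible
  point at that order. Since \<open>g' x0 w = 0\<close>, the value of \<open>g\<close> rises by at
  most that order.\<close>

lemma feasible_arc:
  assumes w: "w \<in> tangent_cone \<Gamma> x0" "g' x0 w = 0"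
  obtains a b where "a \<ge> 0" "b \<ge> 0" "\<forall>\<^sub>F t in at_right (0::real). \<exists>p\<in>\<Gamma>.
     norm (p - x0 - t *\<^sub>R w) \<le> a * t\<^sup>2 \<and> g p \<le> g x0 + b * t\<^sup>2"
proof -
  obtain Kg dg where Kg: "Kg \<ge> 0" "dg > 0"
    "\<And>u. norm u < dg \<Longrightarrow> norm (g (x0 + u) - g x0 - g' x0 u) \<le> Kg * (norm u)\<^sup>2"
    using quadratic_bound[OF U g(1,2)] by blast
  obtain KF dF where KF: "KF \<ge> 0" "dF > 0"
    "\<And>u. norm u < dF \<Longrightarrow> norm (F (x0 + u) - F x0 - F' x0 u) \<le> KF * (norm u)\<^sup>2"
    using quadratic_bound[OF U F(1,2)] by blast
  obtain e where e: "e > 0" "ball x0 e \<subseteq> U" using U open_contains_ball by blast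
  \<comment> \<open>The correction \<open>p - x0 - t w\<close> has size at most
    \<open>a t\<^sup>2\<close>. In \<open>b\<close>, one term is \<open>g' x0\<close> on this
    correction, the other the Taylor remainder of \<open>g\<close>, with
    \<open>norm (p - x0) \<le> t (norm w + a)\<close> for \<open>t \<le> 1\<close>.\<close>
  define a where "a = \<kappa> * (KF * (norm w)\<^sup>2)"
  define b where "b = norm (g' x0) * a + Kg * (norm w + a)\<^sup>2"
  have a: "a \<ge> 0" using \<kappa> KF by (simp add: a_def)
  have b: "b \<ge> 0" using a Kg by (simp add: b_def)
  have small: "\<forall>\<^sub>F t in at_right (0::real). t * c < r" if "r > 0" for c r :: real
    using that by (intro order_tendstoD(2)[of _ 0]) (auto intro!: tendsto_eq_intros)
  have "\<forall>\<^sub>F t in at_right (0::real). \<exists>p\<in>\<Gamma>.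
     norm (p - x0 - t *\<^sub>R w) \<le> a * t\<^sup>2 \<and> g p \<le> g x0 + b * t\<^sup>2"
    using eventually_at_right_less small[OF Kg(2), of "norm w + a"] small[OF KF(2), of "norm w"]
      small[OF e(1), of "norm w"] small[OF zero_less_one, of 1]
  proof eventually_elim
    case (elim t)
    then have tw: "norm (t *\<^sub>R w) = t * norm w" by simp
    have "x0 + t *\<^sub>R w \<in> U" using elim e tw by (intro subsetD[OF e(2)]) (simp add: dist_norm)
    then have 1: "infdist (x0 + t *\<^sub>R w) \<Gamma> \<le> \<kappa> * infdist (F (x0 + t *\<^sub>R w)) C" by (rule err)
    have "t *\<^sub>R F' x0 w \<in> C"
      using C(3) tangent_cone_linearized[OF w(1)] elim unfolding cone_def by simp
    then have "infdist (F (x0 + t *\<^sub>R w)) C \<le> norm (F (x0 + t *\<^sub>R w) - t *\<^sub>R F' x0 w)"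
      using infdist_le[of _ C "F (x0 + t *\<^sub>R w)"] by (simp add: dist_norm)
    also have "\<dots> \<le> KF * (norm (t *\<^sub>R w))\<^sup>2"
      using KF(3)[of "t *\<^sub>R w"] tw elim by (simp add: Fx0 blinfun.scaleR_right)
    finally have "infdist (F (x0 + t *\<^sub>R w)) C \<le> KF * (norm (t *\<^sub>R w))\<^sup>2" .
    from order_trans[OF 1 mult_left_mono[OF this \<kappa>]]
    have "infdist (x0 + t *\<^sub>R w) \<Gamma> \<le> a * t\<^sup>2"
      unfolding tw by (simp add: a_def power_mult_distrib mult_ac)
    moreover obtain p where p: "p \<in> \<Gamma>" "infdist (x0 + t *\<^sub>R w) \<Gamma> = dist (x0 + t *\<^sub>R w) p"
      using infdist_attains_inf[OF \<Gamma>(1)] \<Gamma>(2) by blast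
    ultimately have ps: "norm (p - x0 - t *\<^sub>R w) \<le> a * t\<^sup>2"
      by (simp add: dist_norm norm_minus_commute algebra_simps)
    define s where "s = p - x0 - t *\<^sub>R w"
    have u: "p - x0 = t *\<^sub>R w + s" by (simp add: s_def)
    have "norm (p - x0) \<le> t * norm w + a * t\<^sup>2"
      using norm_triangle_ineq[of "t *\<^sub>R w" s] ps[folded s_def] tw unfolding u by linarith
    also have "a * t\<^sup>2 \<le> a * t"
      using elim a by (intro mult_left_mono) (auto simp: power2_eq_square mult_left_le_one_le)
    finally have pn: "norm (p - x0) \<le> t * (norm w + a)" by (simp add: algebra_simps)
    then have "norm (g p - g x0 - g' x0 (p - x0)) \<le> Kg * (norm (p - x0))\<^sup>2"
      using Kg(3)[of "p - x0"] elim by simp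
    also have "\<dots> \<le> Kg * (t * (norm w + a))\<^sup>2"
      using pn Kg by (intro mult_left_mono power_mono) auto
    finally have 1: "\<bar>g p - g x0 - g' x0 (p - x0)\<bar> \<le> Kg * (norm w + a)\<^sup>2 * t\<^sup>2"
      by (simp add: power_mult_distrib mult_ac)
    have "g' x0 (p - x0) = g' x0 s" unfolding u by (simp add: blinfun.bilinear_simps w(2))
    also have "\<dots> \<le> norm (g' x0) * norm s" using norm_blinfun[of "g' x0" s] by simp
    also have "\<dots> \<le> norm (g' x0) * (a * t\<^sup>2)" using ps[folded s_def] by (intro mult_left_mono) auto
    finally have "g p \<le> g x0 + b * t\<^sup>2" using 1 by (simp add: b_def algebra_simps)
    with p(1) ps show ?case by blast
  qed
  then show ?thesis using that a b by blast
qed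

text \<open>The minimizer \<open>x\<close> of the penalized objective is compared with the feasible
  point \<open>p\<close> of the arc. The quadratic minorant limits what \<open>g\<close> can gain at
  \<open>x\<close>, and a large penalty absorbs the part of that gain due to
  \<open>r\<close>.\<close>

lemma proximal_points:
  assumes w: "w \<in> tangent_cone \<Gamma> x0" "g' x0 w = 0" and ne: "mults \<noteq> {}"
  obtains c R0 where "c \<ge> 0" "R0 > 0" "\<And>R. R \<ge> R0 \<Longrightarrow> \<forall>\<^sub>F t in at_right (0::real).
     \<exists>x. R *\<^sub>R (x0 + t *\<^sub>R w - x) \<in> limiting_subdiff (fobj g \<Gamma>) x \<and> norm (x - x0 - t *\<^sub>R w) \<le> t * sqrt (c / R)"
proof -
  obtain \<nu> where \<nu>: "\<nu> \<in> mults" using ne by blast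
  obtain K d where K: "K \<ge> 0" "d > 0"
    "\<And>x. x \<in> \<Gamma> \<Longrightarrow> norm (x - x0) < d \<Longrightarrow> g x \<ge> g x0 - K * (norm (x - x0))\<^sup>2"
    using quadratic_minorant[OF \<nu>] by blast
  obtain a b where ab: "a \<ge> 0" "b \<ge> 0" and arc: "\<forall>\<^sub>F t in at_right (0::real). \<exists>p\<in>\<Gamma>.
     norm (p - x0 - t *\<^sub>R w) \<le> a * t\<^sup>2 \<and> g p \<le> g x0 + b * t\<^sup>2"
    using feasible_arc[OF w] by blast
  obtain e where e: "e > 0" "cball x0 e \<subseteq> U" using U open_contains_cball by blast
  define \<rho> where "\<rho> = min (d / 2) e"
  have \<rho>: "\<rho> > 0" "\<rho> < d" "cball x0 \<rho> \<subseteq> U" using K e by (auto simp: \<rho>_def)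
  \<comment> \<open>The summands come from the value of \<open>g\<close> at \<open>p\<close>, from
    the minorant along \<open>t w\<close>, and from the penalty at \<open>p\<close>. The factor
    \<open>4\<close> comes from \<open>R / 2 - 2 * K \<ge> R / 4\<close>, which is what
    \<open>R \<ge> 8 * K + 1\<close> ensures.\<close>
  define c where "c = 4 * (b + 2 * K * (norm w)\<^sup>2 + 1)"
  have c: "c \<ge> 0" using ab K by (simp add: c_def)
  have small: "\<forall>\<^sub>F t in at_right (0::real). t * m < r" if "r > 0" for m r :: real
    using that by (intro order_tendstoD(2)[of _ 0]) (auto intro!: tendsto_eq_intros)
  have "\<forall>\<^sub>F t in at_right (0::real). \<exists>x. R *\<^sub>R (x0 + t *\<^sub>R w - x) \<in> limiting_subdiff (fobj g \<Gamma>) x \<and>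
      norm (x - x0 - t *\<^sub>R w) \<le> t * sqrt (c / R)" if R: "R \<ge> 8 * K + 1" for R
  proof -
    have R0: "R > 0" using R K by simp
    \<comment> \<open>With \<open>R\<close> fixed, the penalty at \<open>p\<close> is of order
      \<open>t^4\<close>, hence below \<open>t\<^sup>2\<close> for small \<open>t\<close>.\<close>
    have smallR: "\<forall>\<^sub>F t in at_right (0::real). R / 2 * a\<^sup>2 * t\<^sup>2 < 1"
      by (intro order_tendstoD(2)[of _ 0]) (auto intro!: tendsto_eq_intros)
    show ?thesis
      using arc eventually_at_right_less small[OF \<rho>(1), of "norm w + a"]
        small[OF zero_less_one, of 1] small[OF \<rho>(1), of "norm w + sqrt (c / R)"] smallR
    proof eventually_elim
      case (elim t)
      have t: "t > 0" "t \<le> 1" using elim by auto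
      obtain p where p: "p \<in> \<Gamma>" "norm (p - x0 - t *\<^sub>R w) \<le> a * t\<^sup>2" "g p \<le> g x0 + b * t\<^sup>2"
        using elim by blast
      define \<phi> where "\<phi> x = g x + R / 2 * (norm (x - (x0 + t *\<^sub>R w)))\<^sup>2" for x
      have "norm (p - x0) \<le> t * norm w + a * t\<^sup>2"
        using norm_triangle_ineq[of "t *\<^sub>R w" "p - x0 - t *\<^sub>R w"] p t by simp
      also have "a * t\<^sup>2 \<le> a * t"
        using t ab by (intro mult_left_mono) (auto simp: power2_eq_square mult_left_le_one_le)
      finally have p\<rho>: "p \<in> cball x0 \<rho>"
        using elim by (simp add: dist_norm norm_minus_commute algebra_simps)
      have "continuous_on (\<Gamma> \<inter> cball x0 \<rho>) g"
        using g(1) \<rho>(3) by (meson IntE continuous_at_imp_continuous_on has_derivative_continuous subsetD)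
      then have "continuous_on (\<Gamma> \<inter> cball x0 \<rho>) \<phi>" unfolding \<phi>_def by (intro continuous_intros)
      moreover have "compact (\<Gamma> \<inter> cball x0 \<rho>)" using \<Gamma>(1) by (intro closed_Int_compact) auto
      ultimately obtain x where x: "x \<in> \<Gamma>" "x \<in> cball x0 \<rho>"
        and min: "\<And>u. u \<in> \<Gamma> \<Longrightarrow> u \<in> cball x0 \<rho> \<Longrightarrow> \<phi> x \<le> \<phi> u"
        using continuous_attains_inf[of "\<Gamma> \<inter> cball x0 \<rho>" \<phi>] p(1) p\<rho> by blast
      define r where "r = norm (x - x0 - t *\<^sub>R w)"
      have r: "norm (x - (x0 + t *\<^sub>R w)) = r" by (simp add: r_def algebra_simps)
      have xn: "norm (x - x0) \<le> r + t * norm w"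
        using norm_triangle_ineq[of "x - x0 - t *\<^sub>R w" "t *\<^sub>R w"] t by (simp add: r_def)
      have "(norm (x - x0))\<^sup>2 \<le> (r + t * norm w)\<^sup>2" using xn by (intro power_mono) auto
      also have "\<dots> \<le> 2 * r\<^sup>2 + 2 * (t * norm w)\<^sup>2"
        using sum_squares_bound[of r "t * norm w"] by (simp add: power2_sum)
      finally have "K * (norm (x - x0))\<^sup>2 \<le> K * (2 * r\<^sup>2 + 2 * (t * norm w)\<^sup>2)"
        using K by (intro mult_left_mono)
      moreover have "g x \<ge> g x0 - K * (norm (x - x0))\<^sup>2"
        using x \<rho> by (intro K(3)) (auto simp: dist_norm norm_minus_commute)
      moreover have "g x + R / 2 * r\<^sup>2 \<le> g p + R / 2 * (norm (p - (x0 + t *\<^sub>R w)))\<^sup>2"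
        using min[OF p(1) p\<rho>] unfolding \<phi>_def r .
      moreover have "R / 2 * (norm (p - (x0 + t *\<^sub>R w)))\<^sup>2 \<le> R / 2 * (a * t\<^sup>2)\<^sup>2"
        using p(2) R0 by (intro mult_left_mono power_mono) (auto simp: algebra_simps)
      moreover have "R / 2 * (a * t\<^sup>2)\<^sup>2 \<le> t\<^sup>2"
        using mult_right_mono[OF less_imp_le[OF elim(6)], of "t\<^sup>2"]
        by (simp add: power_mult_distrib power2_eq_square mult_ac)
      ultimately have "R / 2 * r\<^sup>2 \<le> b * t\<^sup>2 + K * (2 * r\<^sup>2 + 2 * (t * norm w)\<^sup>2) + t\<^sup>2"
        using p(3) by linarith
      then have "(R / 2 - 2 * K) * r\<^sup>2 \<le> (c / 4) * t\<^sup>2"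
        by (simp add: c_def power_mult_distrib algebra_simps)
      moreover have "R / 4 * r\<^sup>2 \<le> (R / 2 - 2 * K) * r\<^sup>2" using R by (intro mult_right_mono) auto
      ultimately have "r\<^sup>2 \<le> c / R * t\<^sup>2" using R0 by (simp add: field_simps)
      moreover have "sqrt (c / R * t\<^sup>2) = t * sqrt (c / R)"
        using t by (simp only: real_sqrt_mult real_sqrt_abs abs_of_pos mult.commute)
      ultimately have rb: "r \<le> t * sqrt (c / R)" using real_le_rsqrt by metis
      \<comment> \<open>The minimizer must be interior to the ball before minimality can yield a
        subgradient for \<open>\<Gamma>\<close> alone.\<close>
      then have "norm (x - x0) < \<rho>" using xn elim(5) by (simp add: algebra_simps)
      then have "x \<in> ball x0 \<rho>" by (simp add: dist_norm norm_minus_commute)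
      from regular_subdiff_proximal[OF x(1) this R0, of "x0 + t *\<^sub>R w"] min
      have "R *\<^sub>R (x0 + t *\<^sub>R w - x) \<in> regular_subdiff (fobj g \<Gamma>) x" unfolding \<phi>_def by blast
      with rb show ?case unfolding r_def by (blast intro: regular_subdiff_imp_limiting_subdiff)
    qed
  qed
  then show ?thesis using that[of c "8 * K + 1"] c K by auto
qed

text \<open>For fixed \<open>R\<close> the displacement and the subgradient
  \<open>R (x0 + t w - x)\<close> are both of order \<open>t\<close>. Dividing by \<open>t\<close>
  leaves bounded displacements, and a cluster point of them gives an element of the contingent cone
  of the graph.\<close>

lemma graph_deriv_dense:
  assumes w: "w \<in> tangent_cone \<Gamma> x0" "g' x0 w = 0" and ne: "mults \<noteq> {}"
  obtains c R0 where "c \<ge> 0" "R0 > 0" "\<And>R. R \<ge> R0 \<Longrightarrow>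
     \<exists>w'. R *\<^sub>R (w - w') \<in> graph_deriv (limiting_subdiff (fobj g \<Gamma>)) x0 0 w' \<and> norm (w' - w) \<le> sqrt (c / R)"
proof -
  obtain c R0 where c: "c \<ge> 0" "R0 > 0" and prox: "\<And>R. R \<ge> R0 \<Longrightarrow> \<forall>\<^sub>F t in at_right (0::real).
     \<exists>x. R *\<^sub>R (x0 + t *\<^sub>R w - x) \<in> limiting_subdiff (fobj g \<Gamma>) x \<and> norm (x - x0 - t *\<^sub>R w) \<le> t * sqrt (c / R)"
    using proximal_points[OF assms] by blast
  have "\<exists>w'. R *\<^sub>R (w - w') \<in> graph_deriv (limiting_subdiff (fobj g \<Gamma>)) x0 0 w' \<and> norm (w' - w) \<le> sqrt (c / R)"
    if R: "R \<ge> R0" for R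
  proof -
    obtain \<tau> where \<tau>: "\<tau> > 0" "\<And>t. 0 < t \<Longrightarrow> t < \<tau> \<Longrightarrow> \<exists>x. R *\<^sub>R (x0 + t *\<^sub>R w - x) \<in> limiting_subdiff (fobj g \<Gamma>) x
        \<and> norm (x - x0 - t *\<^sub>R w) \<le> t * sqrt (c / R)"
      using prox[OF R] unfolding eventually_at_right_field by auto
    \<comment> \<open>The factor \<open>\<tau> / 2\<close> keeps every term, including the first,
      below \<open>\<tau>\<close>.\<close>
    define t where "t k = \<tau> / 2 * inverse (real (Suc k))" for k
    have t: "t k > 0" for k using \<tau>(1) by (simp add: t_def)
    have t\<tau>: "t k < \<tau>" for k using \<tau>(1) by (simp add: t_def field_simps add_pos_nonneg)
    have "(\<lambda>k. \<tau> / 2 * inverse (real (Suc k))) \<longlonglongrightarrow> \<tau> / 2 * 0"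
      by (intro tendsto_intros LIMSEQ_inverse_real_of_nat)
    then have tl: "t \<longlonglongrightarrow> 0" by (simp add: t_def[abs_def])
    obtain x where x: "\<And>k. R *\<^sub>R (x0 + t k *\<^sub>R w - x k) \<in> limiting_subdiff (fobj g \<Gamma>) (x k)"
      "\<And>k. norm (x k - x0 - t k *\<^sub>R w) \<le> t k * sqrt (c / R)"
      using \<tau>(2)[OF t t\<tau>] by metis
    define y where "y k = (1 / t k) *\<^sub>R (x k - x0 - t k *\<^sub>R w)" for k
    have xy: "x k = x0 + t k *\<^sub>R (w + y k)" for k
      using t[of k] by (simp add: y_def algebra_simps)
    have "norm (y k) \<le> sqrt (c / R)" for k
      using x(2)[of k] t[of k] unfolding y_def norm_scaleR by (simp add: pos_divide_le_eq mult.commute)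
    then obtain l r where l: "norm l \<le> sqrt (c / R)" "strict_mono r" "(\<lambda>k. y (r k)) \<longlonglongrightarrow> l"
      by (rule bounded_subsequence)
    have "(w + l, R *\<^sub>R (w - (w + l))) \<in> tangent_cone (graph_of (limiting_subdiff (fobj g \<Gamma>))) (x0, 0)"
      unfolding tangent_cone_def
    proof (intro CollectI exI conjI allI)
      show "t (r k) > 0" for k by (rule t)
      show "(\<lambda>k. t (r k)) \<longlonglongrightarrow> 0" using LIMSEQ_subseq_LIMSEQ[OF tl l(2)] by (simp add: comp_def)
      show "(\<lambda>k. (w + y (r k), R *\<^sub>R (w - (w + y (r k))))) \<longlonglongrightarrow> (w + l, R *\<^sub>R (w - (w + l)))"
        by (intro tendsto_intros l)
      fix k
      have "R *\<^sub>R (x0 + t (r k) *\<^sub>R w - x (r k)) = t (r k) *\<^sub>R (R *\<^sub>R (w - (w + y (r k))))"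
        by (simp add: xy algebra_simps)
      then show "(x0, 0) + t (r k) *\<^sub>R (w + y (r k), R *\<^sub>R (w - (w + y (r k))))
          \<in> graph_of (limiting_subdiff (fobj g \<Gamma>))"
        using x(1)[of "r k"] by (simp add: graph_of_def flip: xy)
    qed
    then show ?thesis using l(1) unfolding graph_deriv_def by (intro exI[of _ "w + l"]) simp
  qed
  then show ?thesis using that c by blast
qed

section \<open>Graphical derivative and second-order condition\<close>

text \<open>At the approximating directions the estimate
  \<open>z \<bullet> w' \<le> Q \<mu> w'\<close> gives multipliers with nonnegative form. Their
  bound does not depend on the direction, so directions and multipliers converge together along a
  subsequence, and \<open>Q\<close> is jointly continuous.\<close>

lemma second_order_if_graph_deriv:
  assumes w: "w \<in> tangent_cone \<Gamma> x0" "g' x0 w = 0" and ne: "mults \<noteq> {}"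
    and iii: "\<And>w. w \<in> graph_deriv_dom (limiting_subdiff (fobj g \<Gamma>)) x0 0 \<Longrightarrow>
        \<exists>z\<in>graph_deriv (limiting_subdiff (fobj g \<Gamma>)) x0 0 w. z \<bullet> w \<ge> 0"
  shows "\<exists>\<mu>\<in>mults. Q \<mu> w \<ge> 0"
proof -
  obtain c R0 where c: "c \<ge> 0" "R0 > 0" and dense: "\<And>R. R \<ge> R0 \<Longrightarrow>
     \<exists>w'. R *\<^sub>R (w - w') \<in> graph_deriv (limiting_subdiff (fobj g \<Gamma>)) x0 0 w' \<and> norm (w' - w) \<le> sqrt (c / R)"
    using graph_deriv_dense[OF w ne] by blast
  have "\<exists>w' \<mu>. norm (w' - w) \<le> sqrt (c / (R0 + real k)) \<and> \<mu> \<in> mults \<and>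
      norm \<mu> \<le> \<kappa> * norm (grad x0) \<and> Q \<mu> w' \<ge> 0" for k
  proof -
    obtain w' where w': "(R0 + real k) *\<^sub>R (w - w') \<in> graph_deriv (limiting_subdiff (fobj g \<Gamma>)) x0 0 w'"
      "norm (w' - w) \<le> sqrt (c / (R0 + real k))"
      using dense[of "R0 + real k"] by auto
    then obtain z where z: "z \<in> graph_deriv (limiting_subdiff (fobj g \<Gamma>)) x0 0 w'" "z \<bullet> w' \<ge> 0"
      using iii[of w'] unfolding graph_deriv_dom_def by blast
    from z(1) obtain \<mu> where "\<mu> \<in> mults" "norm \<mu> \<le> \<kappa> * norm (grad x0)" "z \<bullet> w' \<le> Q \<mu> w'"
      by (rule graph_deriv_multiplier)
    with w'(2) z(2) show ?thesis by (meson order_trans)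
  qed
  then obtain ws \<mu>s where s: "\<And>k. norm (ws k - w) \<le> sqrt (c / (R0 + real k))" "\<And>k. \<mu>s k \<in> mults"
    "\<And>k. norm (\<mu>s k) \<le> \<kappa> * norm (grad x0)" "\<And>k. Q (\<mu>s k) (ws k) \<ge> 0" by metis
  obtain \<mu> r where \<mu>: "strict_mono r" "(\<lambda>k. \<mu>s (r k)) \<longlonglongrightarrow> \<mu>"
    by (rule bounded_subsequence[OF s(3)])
  have "(\<lambda>k. ws k - w) \<longlonglongrightarrow> 0"
    using s(1) by (rule Lim_null_comparison[OF always_eventually[OF allI] sqrt_divide_tendsto_0])
  then have "ws \<longlonglongrightarrow> w" by (simp add: LIM_zero_iff)
  from LIMSEQ_subseq_LIMSEQ[OF this \<mu>(1)] have wr: "(\<lambda>k. ws (r k)) \<longlonglongrightarrow> w" by (simp add: comp_def)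
  have "(\<lambda>k. Q (\<mu>s (r k)) (ws (r k))) \<longlonglongrightarrow> Q \<mu> w"
    unfolding Q_def by (intro tendsto_intros wr \<mu>(2))
  then have "Q \<mu> w \<ge> 0" using s(4) by (intro LIMSEQ_le_const) auto
  moreover have "\<mu> \<in> mults"
  proof -
    have "\<mu> \<bullet> c \<le> 0" if "c \<in> C" for c
      using s(2) that by (intro LIMSEQ_le_const2[OF tendsto_inner[OF \<mu>(2) tendsto_const]]) (auto simp: mults_def)
    moreover have "g' x0 u + \<mu> \<bullet> F' x0 u = 0" for u
    proof (rule LIMSEQ_unique)
      show "(\<lambda>k. g' x0 u + \<mu>s (r k) \<bullet> F' x0 u) \<longlonglongrightarrow> g' x0 u + \<mu> \<bullet> F' x0 u"
        by (intro tendsto_intros \<mu>)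
      show "(\<lambda>k. g' x0 u + \<mu>s (r k) \<bullet> F' x0 u) \<longlonglongrightarrow> 0" using s(2) by (simp add: mults_def)
    qed
    ultimately show ?thesis by (simp add: mults_def)
  qed
  ultimately show ?thesis by blast
qed

text \<open>The two estimates combine to \<open>Q \<nu> w \<le> z \<bullet> w\<close> for every
  multiplier \<open>\<nu>\<close>.\<close>

lemma graph_deriv_nonneg_if_second_order:
  assumes z: "z \<in> graph_deriv (limiting_subdiff (fobj g \<Gamma>)) x0 0 w"
    and iv: "\<And>w. w \<in> tangent_cone \<Gamma> x0 \<Longrightarrow> g' x0 w = 0 \<Longrightarrow> \<exists>\<mu>\<in>mults. Q \<mu> w \<ge> 0"
  shows "z \<bullet> w \<ge> 0"
proof -
  obtain \<mu> where \<mu>: "w \<in> tangent_cone \<Gamma> x0" "g' x0 w = 0" "z \<bullet> w \<le> Q \<mu> w"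
    "\<And>\<nu>. \<nu> \<in> mults \<Longrightarrow> Q \<mu> w + Q \<nu> w \<le> 2 * (z \<bullet> w)"
    by (rule graph_deriv_multiplier[OF z]) blast
  obtain \<nu> where "\<nu> \<in> mults" "Q \<nu> w \<ge> 0" using iv[OF \<mu>(1,2)] by blast
  with \<mu>(3) \<mu>(4)[of \<nu>] show ?thesis by linarith
qed

text \<open>The chain \<open>z \<bullet> w \<le> Q \<mu> w \<le> 2 * (z \<bullet> w)\<close> forces
  nonnegativity.\<close>

lemma graph_deriv_nonneg_if_local_min:
  assumes z: "z \<in> graph_deriv (limiting_subdiff (fobj g \<Gamma>)) x0 0 w"
    and d: "d > 0" "\<forall>x\<in>\<Gamma>. dist x x0 < d \<longrightarrow> g x0 \<le> g x"
  shows "z \<bullet> w \<ge> 0"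
proof -
  obtain \<mu> where \<mu>: "z \<bullet> w \<le> Q \<mu> w"
    "\<And>d. d > 0 \<Longrightarrow> \<forall>x\<in>\<Gamma>. dist x x0 < d \<longrightarrow> g x0 \<le> g x \<Longrightarrow> Q \<mu> w \<le> 2 * (z \<bullet> w)"
    by (rule graph_deriv_multiplier[OF z]) blast
  from \<mu>(1) \<mu>(2)[OF d] show ?thesis by linarith
qed

end

section \<open>Reduction\<close>

text \<open>For one inclusion, convexity keeps the segment from \<open>y0\<close> to
  \<open>y\<close> in \<open>\<Theta>\<close>, and differentiating \<open>h\<close> along it gives a
  direction on which the polar acts. For the other, metric regularity makes each \<open>u\<close>
  with \<open>h' y0 u\<close> in \<open>C\<close> tangent to \<open>\<Theta>\<close>, so that
  \<open>lam\<close> vanishes on the kernel of \<open>h' y0\<close> and factors through it.\<close>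

lemma normal_cone_cvx_reduction:
  fixes h :: "'a::euclidean_space \<Rightarrow> 'b::euclidean_space" and h' :: "'a \<Rightarrow> 'a \<Rightarrow>\<^sub>L 'b"
  assumes V: "open V" "y0 \<in> V"
    and h: "\<And>y. y \<in> V \<Longrightarrow> (h has_derivative h' y) (at y)"
    and cont: "continuous (at y0) h'" and surj: "surj (h' y0)"
    and \<Theta>: "convex \<Theta>" "\<Theta> \<inter> V = {y \<in> V. h y \<in> C}" and C: "cone C" and h0: "h y0 = 0" "y0 \<in> \<Theta>"
  shows "normal_cone_cvx \<Theta> y0 = adjoint (h' y0) ` {\<mu>. \<forall>c\<in>C. \<mu> \<bullet> c \<le> 0}"
proof (intro equalityI subsetI)
  have lin: "linear (h' y0)" by (simp add: blinfun.bounded_linear_right bounded_linear.linear)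
  define t where "t k = inverse (real (Suc k))" for k
  have t: "t k > 0" "t \<longlonglongrightarrow> 0" "t k \<le> 1" for k
    using LIMSEQ_inverse_real_of_nat by (auto simp: t_def[abs_def] field_simps)
  have arc: "(\<lambda>k. y0 + t k *\<^sub>R u) \<longlonglongrightarrow> y0" for u
    using tendsto_add[OF tendsto_const tendsto_scaleR[OF t(2) tendsto_const], of y0 u] by simp
  have arcV: "\<forall>\<^sub>F k in sequentially. y0 + t k *\<^sub>R u \<in> V" for u
    using topological_tendstoD[OF arc V] .
  have dq: "(\<lambda>k. (1 / t k) *\<^sub>R h (y0 + t k *\<^sub>R u)) \<longlonglongrightarrow> h' y0 u" for u
    using has_derivative_tendsto_along[OF h[OF V(2)] t(1,2) tendsto_const[of u]] by (simp add: h0)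
  {
    fix lam assume "lam \<in> adjoint (h' y0) ` {\<mu>. \<forall>c\<in>C. \<mu> \<bullet> c \<le> 0}"
    then obtain \<mu> where \<mu>: "lam = adjoint (h' y0) \<mu>" "\<And>c. c \<in> C \<Longrightarrow> \<mu> \<bullet> c \<le> 0" by blast
    show "lam \<in> normal_cone_cvx \<Theta> y0"
      unfolding normal_cone_cvx_def
    proof (intro CollectI ballI)
      fix y assume y: "y \<in> \<Theta>"
      have "\<mu> \<bullet> h' y0 (y - y0) \<le> 0"
      proof (rule tendsto_upperbound[OF tendsto_inner[OF tendsto_const dq]])
        show "\<forall>\<^sub>F k in sequentially. \<mu> \<bullet> (1 / t k) *\<^sub>R h (y0 + t k *\<^sub>R (y - y0)) \<le> 0"
          using arcV[of "y - y0"]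
        proof eventually_elim
          case (elim k)
          have "(1 - t k) *\<^sub>R y0 + t k *\<^sub>R y \<in> \<Theta>"
            using t(1,3)[of k] by (intro convexD[OF \<Theta>(1) h0(2) y]) auto
          then have "y0 + t k *\<^sub>R (y - y0) \<in> \<Theta>" by (simp add: algebra_simps)
          then have "h (y0 + t k *\<^sub>R (y - y0)) \<in> C" using \<Theta>(2) elim by blast
          then show ?case using \<mu>(2) t(1)[of k] by (simp add: divide_nonpos_pos)
        qed
      qed simp
      then show "lam \<bullet> (y - y0) \<le> 0"
        using adjoint_works[OF lin, of "y - y0" \<mu>] by (simp add: \<mu>(1) inner_commute)
    qed
  }
  {
    fix lam assume lam: "lam \<in> normal_cone_cvx \<Theta> y0"
    obtain a d where a: "a > 0" "d > 0" and reg: "\<And>y c. dist y y0 < d \<Longrightarrow> dist c (h y0) < d \<Longrightarrow>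
       \<exists>y'\<in>V. h y' = c \<and> norm (y' - y) \<le> a * norm (c - h y)"
      using metric_regular_surj_derivative[OF V h cont surj] by blast
    have polar: "lam \<bullet> u \<le> 0" if u: "h' y0 u \<in> C" for u
    proof -
      have "(\<lambda>k. t k *\<^sub>R h' y0 u) \<longlonglongrightarrow> 0"
        using tendsto_scaleR[OF t(2) tendsto_const, of "h' y0 u"] by simp
      from eventually_conj[OF tendstoD[OF this a(2)] tendstoD[OF arc[of u] a(2)]]
      have "\<forall>\<^sub>F k in sequentially. lam \<bullet> u \<le> norm lam * (a * norm (h' y0 u - (1 / t k) *\<^sub>R h (y0 + t k *\<^sub>R u)))"
      proof eventually_elim
        case (elim k)
        then obtain y' where y': "y' \<in> V" "h y' = t k *\<^sub>R h' y0 u"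
          "norm (y' - (y0 + t k *\<^sub>R u)) \<le> a * norm (t k *\<^sub>R h' y0 u - h (y0 + t k *\<^sub>R u))"
          using reg[of "y0 + t k *\<^sub>R u" "t k *\<^sub>R h' y0 u"] by (auto simp: h0)
        have "t k *\<^sub>R h' y0 u \<in> C" using C u t(1)[of k] unfolding cone_def by simp
        then have "y' \<in> \<Theta> \<inter> V" unfolding \<Theta>(2) by (simp add: y'(1,2))
        then have "lam \<bullet> (y' - y0) \<le> 0" using lam by (simp add: normal_cone_cvx_def)
        then have "t k * (lam \<bullet> u) \<le> lam \<bullet> (y0 + t k *\<^sub>R u - y')"
          by (simp add: inner_diff_right inner_add_right)
        also have "\<dots> \<le> norm lam * norm (y' - (y0 + t k *\<^sub>R u))"
          by (metis norm_cauchy_schwarz norm_minus_commute)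
        also have "\<dots> \<le> norm lam * (a * norm (t k *\<^sub>R h' y0 u - h (y0 + t k *\<^sub>R u)))"
          using y'(3) by (intro mult_left_mono) auto
        also have "t k *\<^sub>R h' y0 u - h (y0 + t k *\<^sub>R u) = t k *\<^sub>R (h' y0 u - (1 / t k) *\<^sub>R h (y0 + t k *\<^sub>R u))"
          using t(1)[of k] by (simp add: scaleR_diff_right)
        finally have "t k * (lam \<bullet> u) \<le> t k * (norm lam * (a * norm (h' y0 u - (1 / t k) *\<^sub>R h (y0 + t k *\<^sub>R u))))"
          using t(1)[of k] by (simp add: mult_ac)
        then show ?case using t(1)[of k] by simp
      qed
      moreover have "(\<lambda>k. norm lam * (a * norm (h' y0 u - (1 / t k) *\<^sub>R h (y0 + t k *\<^sub>R u))))
          \<longlonglongrightarrow> norm lam * (a * norm (h' y0 u - h' y0 u))"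
        by (intro tendsto_intros dq)
      ultimately have "lam \<bullet> u \<le> norm lam * (a * norm (h' y0 u - h' y0 u))"
        by (intro tendsto_lowerbound) auto
      then show ?thesis by simp
    qed
    obtain B where B: "linear B" "\<And>s. h' y0 (B s) = s"
      using linear_surjective_right_inverse[OF lin surj] by (auto simp: fun_eq_iff)
    define \<mu> where "\<mu> = adjoint B lam"
    have \<mu>: "\<mu> \<bullet> s = lam \<bullet> B s" for s
      using adjoint_works[OF B(1), of s lam] by (simp add: \<mu>_def inner_commute)
    have "y0 \<in> \<Theta> \<inter> V" using V(2) h0 by blast
    then have "0 \<in> C" unfolding \<Theta>(2) by (simp add: h0(1))
    have "lam = adjoint (h' y0) \<mu>"
    proof (rule vector_eq_ldot[THEN iffD1], rule allI)
      fix u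
      \<comment> \<open>Both vectors lie in the kernel of \<open>h' y0\<close>, so
        \<open>polar\<close> applies to each with the value \<open>0\<close> in
        \<open>C\<close>.\<close>
      have "lam \<bullet> (u - B (h' y0 u)) \<le> 0" "lam \<bullet> (B (h' y0 u) - u) \<le> 0"
        using \<open>0 \<in> C\<close> by (auto intro!: polar simp: blinfun.diff_right B(2))
      then show "u \<bullet> lam = u \<bullet> adjoint (h' y0) \<mu>"
        using \<mu>[of "h' y0 u"] by (simp add: adjoint_works[OF lin] inner_diff_right inner_commute)
    qed
    moreover have "\<mu> \<bullet> c \<le> 0" if "c \<in> C" for c using polar[of "B c"] that by (simp add: \<mu> B(2))
    ultimately show "lam \<in> adjoint (h' y0) ` {\<mu>. \<forall>c\<in>C. \<mu> \<bullet> c \<le> 0}" by blast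
  }
qed

section \<open>Derivatives and multipliers as they appear in the statement\<close>

lemma D1_eq: "(F has_derivative F') (at x) \<Longrightarrow> D1 F x v = F' v"
  unfolding D1_def by (simp flip: frechet_derivative_at)

lemma D2_eq:
  assumes "open S" "x \<in> S" "\<And>y. y \<in> S \<Longrightarrow> (F has_derivative F' y) (at y)"
    and "((\<lambda>y. F' y v) has_derivative F2) (at x)"
  shows "D2 F x v w = F2 w"
proof -
  have "((\<lambda>y. D1 F y v) has_derivative F2) (at x)"
    using has_derivative_transform_within_open[OF assms(4,1,2)] D1_eq[OF assms(3)] by metis
  then show ?thesis unfolding D2_def by (simp flip: frechet_derivative_at)
qed

text \<open>Surjectivity of \<open>h'\<close> makes its adjoint injective, so the definite
  description has a unique solution.\<close>

lemma mu_of_adjoint: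
  fixes h :: "'b::euclidean_space \<Rightarrow> 'c::euclidean_space"
  assumes h: "(h has_derivative h') (at y)" and surj: "surj h'"
  shows "mu_of h y (adjoint h' \<mu>) = \<mu>"
proof -
  have lin: "linear h'" using h has_derivative_linear by blast
  have works: "adjoint h' \<mu> \<bullet> v = \<mu> \<bullet> h' v" for v
    using adjoint_works[OF lin, of v \<mu>] by (simp add: inner_commute)
  show ?thesis
    unfolding mu_of_def works D1_eq[OF h]
  proof (rule the_equality)
    fix \<nu> assume "\<forall>v. \<nu> \<bullet> h' v = \<mu> \<bullet> h' v"
    then have "\<forall>c. \<nu> \<bullet> c = \<mu> \<bullet> c" using surj by (metis surjD)
    then show "\<nu> = \<mu>" by (simp add: vector_eq_rdot)
  qed simp
qed

section \<open>Transfer to the original problem\<close>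

theorem theorem4p5:
  fixes g :: "real^'n \<Rightarrow> real" and q :: "real^'n \<Rightarrow> real^'m"
    and \<Theta> :: "(real^'m) set" and xbar :: "real^'n"
    and V :: "(real^'m) set" and h :: "real^'m \<Rightarrow> real^'l" and C :: "(real^'l) set"
  defines "\<Gamma> \<equiv> {x. q x \<in> \<Theta>}"
  defines "ybar \<equiv> q xbar"
  assumes g_C2: "C2_on UNIV g" and q_C2: "C2_on UNIV q"
    and Theta: "\<Theta> \<noteq> {}" "closed \<Theta>" "convex \<Theta>"
    and xbar_feas: "xbar \<in> \<Gamma>"
    and C_cone: "closed C" "convex C" "pointed_cone C"
    and reduc: "open V" "ybar \<in> V" "C2_on V h" "h ybar = 0"
               "surj (D1 h ybar)" "\<Theta> \<inter> V = {y \<in> V. h y \<in> C}"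
    and MSCQ: "\<exists>\<kappa>>0. \<exists>\<delta>>0. \<forall>x. dist x xbar < \<delta> \<longrightarrow>
                  infdist x \<Gamma> \<le> \<kappa> * infdist (q x) \<Theta>"
    and stationary: "multipliers g q \<Theta> xbar \<noteq> {}"
  shows "let f = fobj g \<Gamma>;
             DF = graph_deriv (limiting_subdiff f) xbar 0;
             domDF = graph_deriv_dom (limiting_subdiff f) xbar 0;
             Kbar = tangent_cone \<Gamma> xbar \<inter> {w. D1 g xbar w = 0};
             L = (\<lambda>lam x. g x + lam \<bullet> q x);
             Htil = (\<lambda>lam w. D2 (\<lambda>y. mu_of h ybar lam \<bullet> h y) ybar (D1 q xbar w) (D1 q xbar w));
             i = (\<exists>\<delta>>0. \<forall>x\<in>\<Gamma>. dist x xbar < \<delta> \<longrightarrow> g xbar \<le> g x);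
             ii = (\<forall>w\<in>domDF. \<forall>z\<in>DF w. z \<bullet> w \<ge> 0);
             iii = (\<forall>w\<in>domDF. \<exists>z\<in>DF w. z \<bullet> w \<ge> 0);
             iv = (\<forall>w\<in>Kbar. \<exists>lam\<in>multipliers g q \<Theta> xbar.
                      D2 (L lam) xbar w w + Htil lam w \<ge> 0)
         in (i \<longrightarrow> ii) \<and> (ii \<longleftrightarrow> iii) \<and> (iii \<longleftrightarrow> iv)"
proof -
  obtain g1 :: "real^'n \<Rightarrow> (real^'n) \<Rightarrow>\<^sub>L real" and g2 where
    g1: "\<And>x. (g has_derivative g1 x) (at x)" and g2: "\<And>x. (g1 has_derivative blinfun_apply (g2 x)) (at x)"
    using g_C2 unfolding C2_on_def by auto
  obtain q1 :: "real^'n \<Rightarrow> (real^'n) \<Rightarrow>\<^sub>L (real^'m)" and q2 where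
    q1: "\<And>x. (q has_derivative q1 x) (at x)" and q2: "\<And>x. (q1 has_derivative blinfun_apply (q2 x)) (at x)"
    using q_C2 unfolding C2_on_def by auto
  obtain h1 :: "real^'m \<Rightarrow> (real^'m) \<Rightarrow>\<^sub>L (real^'l)" and h2 where
    h1: "\<And>y. y \<in> V \<Longrightarrow> (h has_derivative h1 y) (at y)"
    and h2: "\<And>y. y \<in> V \<Longrightarrow> (h1 has_derivative blinfun_apply (h2 y)) (at y)"
    using reduc(3) unfolding C2_on_def by auto
  have D1: "D1 g xbar w = g1 xbar w" "D1 q xbar w = q1 xbar w" "D1 h ybar v = h1 ybar v" for w v
    using D1_eq[OF g1] D1_eq[OF q1] D1_eq[OF h1[OF reduc(2)]] by blast+
  have surj: "surj (h1 ybar)" using reduc(5) D1(3) by (metis ext)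
  have cont_h1: "continuous (at ybar) h1" using has_derivative_continuous[OF h2[OF reduc(2)]] .
  have lin: "linear (h1 ybar)" by (simp add: blinfun.bounded_linear_right bounded_linear.linear)
  have cone: "cone C" using C_cone(3) by (simp add: pointed_cone_def)
  have y\<Theta>: "ybar \<in> \<Theta>" using xbar_feas by (simp add: \<Gamma>_def ybar_def)
  have contq: "continuous_on UNIV q" "isCont q x" for x
    using has_derivative_continuous[OF q1] by (auto intro: continuous_at_imp_continuous_on)
  define F where "F = h \<circ> q"
  define F1 where "F1 x = h1 (q x) o\<^sub>L q1 x" for x
  \<comment> \<open>The product rule for \<open>F1\<close>: the first term carries the curvature of
    \<open>q\<close>, the second that of \<open>h\<close>, from which the extra term of (iv)
    arises.\<close>
  define D where "D u = (h1 ybar o\<^sub>L q2 xbar u) + (h2 ybar (q1 xbar u) o\<^sub>L q1 xbar)" for u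
  define F2 where "F2 = Blinfun D"
  obtain a d where a: "a > 0" "d > 0" and reg: "\<And>y c. dist y ybar < d \<Longrightarrow> dist c (h ybar) < d \<Longrightarrow>
       \<exists>y'\<in>V. h y' = c \<and> norm (y' - y) \<le> a * norm (c - h y)"
    using metric_regular_surj_derivative[OF reduc(1,2) h1 cont_h1 surj] by blast
  obtain \<kappa> \<delta> where \<kappa>: "\<kappa> > 0" "\<delta> > 0" and mscq: "\<And>x. dist x xbar < \<delta> \<Longrightarrow>
      infdist x \<Gamma> \<le> \<kappa> * infdist (q x) \<Theta>" using MSCQ by blast
  have "isCont h (q xbar)"
    using has_derivative_continuous[OF h1[OF reduc(2)]] by (simp add: ybar_def)
  then have hq: "isCont (\<lambda>x. h (q x)) xbar" by (rule isCont_o2[OF contq(2)])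
  \<comment> \<open>The radius is \<open>d / 2\<close> because a nearest point of \<open>C\<close>
    to \<open>h (q x)\<close> has at most twice its norm, and must stay within
    \<open>d\<close>.\<close>
  have "\<forall>\<^sub>F x in nhds xbar. dist x xbar < \<delta> \<and> q x \<in> V \<and> dist (q x) ybar < d \<and> dist (h (q x)) 0 < d / 2"
  proof (intro eventually_conj)
    have q: "(q \<longlongrightarrow> ybar) (nhds xbar)"
      using contq(2)[of xbar] by (simp add: isCont_def tendsto_at_iff_tendsto_nhds ybar_def)
    have hq': "((\<lambda>x. h (q x)) \<longlongrightarrow> 0) (nhds xbar)"
      using tendsto_at_iff_tendsto_nhds[of "\<lambda>x. h (q x)", THEN iffD1, OF hq[unfolded isCont_def]] reduc(4)
      by (simp add: ybar_def)
    show "\<forall>\<^sub>F x in nhds xbar. dist x xbar < \<delta>"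
      using \<kappa>(2) by (auto simp: eventually_nhds_metric)
    show "\<forall>\<^sub>F x in nhds xbar. q x \<in> V" using topological_tendstoD[OF q reduc(1,2)] .
    show "\<forall>\<^sub>F x in nhds xbar. dist (q x) ybar < d" using tendstoD[OF q a(2)] .
    show "\<forall>\<^sub>F x in nhds xbar. dist (h (q x)) 0 < d / 2" using tendstoD[OF hq', of "d / 2"] a(2) by simp
  qed
  then obtain U where U: "open U" "xbar \<in> U" and
    near: "\<And>x. x \<in> U \<Longrightarrow> dist x xbar < \<delta>" "\<And>x. x \<in> U \<Longrightarrow> q x \<in> V"
      "\<And>x. x \<in> U \<Longrightarrow> dist (q x) ybar < d" "\<And>x. x \<in> U \<Longrightarrow> dist (h (q x)) 0 < d / 2"
    unfolding eventually_nhds by blast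
  have F1: "(F has_derivative F1 x) (at x)" if "x \<in> U" for x
    using diff_chain_at[OF q1 h1[OF near(2)[OF that]]] by (simp add: F_def F1_def comp_def blinfun_compose.rep_eq)
  have F1': "(F1 has_derivative (\<lambda>u. (h1 (q x) o\<^sub>L q2 x u) + (h2 (q x) (q1 x u) o\<^sub>L q1 x))) (at x)" if "x \<in> U" for x
    unfolding F1_def
    using bounded_bilinear.FDERIV[OF bounded_bilinear_blinfun_compose
        diff_chain_at[OF q1 h2[OF near(2)[OF that]], unfolded comp_def] q2] .
  have F2: "(F1 has_derivative F2) (at xbar)" and F2_eq: "F2 u = D u" for u
  proof -
    have "(F1 has_derivative D) (at xbar)" using F1'[OF U(2)] by (simp add: D_def[abs_def] ybar_def)
    moreover from this have "blinfun_apply F2 = D"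
      unfolding F2_def by (intro bounded_linear_Blinfun_apply has_derivative_bounded_linear)
    ultimately show "(F1 has_derivative F2) (at xbar)" "F2 u = D u" by simp_all
  qed
  interpret R: reduced_problem g g1 "g2 xbar" F F1 F2 U \<Gamma> C xbar "\<kappa> * a"
  proof
    show "continuous_on U g1" "continuous_on U F1"
      using has_derivative_continuous[OF g2] has_derivative_continuous[OF F1']
      by (auto intro!: continuous_at_imp_continuous_on)
    show "F xbar = 0" using reduc(4) by (simp add: F_def ybar_def)
    show "closed \<Gamma>"
      using continuous_closed_vimage[OF Theta(2) contq(2)] by (simp add: \<Gamma>_def vimage_def)
    show "x \<in> \<Gamma> \<longleftrightarrow> F x \<in> C" if "x \<in> U" for x
    proof -
      have "q x \<in> \<Theta> \<longleftrightarrow> q x \<in> \<Theta> \<inter> V" using near(2)[OF that] by blast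
      also have "\<dots> \<longleftrightarrow> F x \<in> C" unfolding reduc(6) using near(2)[OF that] by (simp add: F_def)
      finally show ?thesis by (simp add: \<Gamma>_def)
    qed
    \<comment> \<open>Metric regularity lifts a nearest point of \<open>C\<close> to a point of
      \<open>\<Theta>\<close> near \<open>q x\<close>. This bounds the distance to
      \<open>\<Theta>\<close> by \<open>a\<close> times the distance to \<open>C\<close>, and MSCQ
      contributes \<open>\<kappa>\<close>.\<close>
    show "infdist x \<Gamma> \<le> \<kappa> * a * infdist (F x) C" if x: "x \<in> U" for x
    proof -
      have "ybar \<in> \<Theta> \<inter> V" using reduc(2) y\<Theta> by blast
      then have 0: "0 \<in> C" unfolding reduc(6) by (simp add: reduc(4))
      obtain c where c: "c \<in> C" "infdist (F x) C = dist (F x) c"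
        using infdist_attains_inf[OF C_cone(1)] 0 by blast
      have "dist (F x) c \<le> dist (F x) 0" using infdist_le[OF 0, of "F x"] c(2) by simp
      then have "dist c 0 < d" using near(4)[OF x] dist_triangle3[of c 0 "F x"] by (simp add: F_def)
      then obtain y' where y': "y' \<in> V" "h y' = c" "norm (y' - q x) \<le> a * norm (c - h (q x))"
        using reg[OF near(3)[OF x], of c] reduc(4) by auto
      have "y' \<in> \<Theta> \<inter> V" unfolding reduc(6) using y'(1,2) c(1) by simp
      then have "y' \<in> \<Theta>" by blast
      then have "infdist (q x) \<Theta> \<le> a * infdist (F x) C"
        using infdist_le[of y' \<Theta> "q x"] y'(3) c(2) by (simp add: dist_norm norm_minus_commute F_def)
      from order_trans[OF mscq[OF near(1)[OF x]] mult_left_mono[OF this]] show ?thesis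
        using \<kappa> by (simp add: mult.assoc)
    qed
  qed (use U g1 g2 F1 F2 C_cone cone xbar_feas \<kappa> a in \<open>auto simp: less_imp_le\<close>)
  have mult: "multipliers g q \<Theta> xbar = adjoint (h1 ybar) ` R.mults"
  proof -
    have adj: "adjoint (h1 ybar) \<mu> \<bullet> v = \<mu> \<bullet> h1 ybar v" for \<mu> v
      using adjoint_works[OF lin, of v \<mu>] by (simp add: inner_commute)
    have N: "normal_cone_cvx \<Theta> ybar = adjoint (h1 ybar) ` {\<mu>. \<forall>c\<in>C. \<mu> \<bullet> c \<le> 0}"
      using normal_cone_cvx_reduction[OF reduc(1,2) h1 cont_h1 surj Theta(3) reduc(6) cone reduc(4) y\<Theta>] .
    show ?thesis
      unfolding multipliers_def R.mults_def ybar_def[symmetric]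
      by (auto simp: N D1 adj F1_def ybar_def[symmetric])
  qed
  \<comment> \<open>The \<open>q\<close> term of the Lagrangian is
    \<open>\<mu> \<bullet> h1 ybar (q2 xbar w w)\<close>, and the term with \<open>mu_of\<close> is
    \<open>\<mu> \<bullet> h2 ybar (q1 xbar w) (q1 xbar w)\<close>; together they are
    \<open>\<mu> \<bullet> F2 w w\<close>.\<close>
  have val: "D2 (\<lambda>x. g x + adjoint (h1 ybar) \<mu> \<bullet> q x) xbar w w
      + D2 (\<lambda>y. mu_of h ybar (adjoint (h1 ybar) \<mu>) \<bullet> h y) ybar (D1 q xbar w) (D1 q xbar w) = R.Q \<mu> w" for \<mu> w
  proof -
    let ?l = "adjoint (h1 ybar) \<mu>"
    have adj: "?l \<bullet> v = \<mu> \<bullet> h1 ybar v" for v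
      using adjoint_works[OF lin, of v \<mu>] by (simp add: inner_commute)
    have "D2 (\<lambda>x. g x + ?l \<bullet> q x) xbar w w = g2 xbar w w + ?l \<bullet> q2 xbar w w"
    proof (rule D2_eq[where S = UNIV and F' = "\<lambda>x u. g1 x u + ?l \<bullet> q1 x u"
          and ?F2.0 = "\<lambda>u. g2 xbar u w + ?l \<bullet> q2 xbar u w"])
      show "((\<lambda>x. g x + ?l \<bullet> q x) has_derivative (\<lambda>u. g1 y u + ?l \<bullet> q1 y u)) (at y)" for y
        by (intro has_derivative_add g1 has_derivative_inner_right q1)
      show "((\<lambda>y. g1 y w + ?l \<bullet> q1 y w) has_derivative (\<lambda>u. g2 xbar u w + ?l \<bullet> q2 xbar u w)) (at xbar)"
        by (intro has_derivative_add has_derivative_inner_right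
            bounded_linear.has_derivative[OF blinfun.bounded_linear_left] g2 q2)
    qed auto
    moreover have "D2 (\<lambda>y. \<mu> \<bullet> h y) ybar v v = \<mu> \<bullet> h2 ybar v v" for v
    proof (rule D2_eq[where S = V and F' = "\<lambda>y u. \<mu> \<bullet> h1 y u"
          and ?F2.0 = "\<lambda>u. \<mu> \<bullet> h2 ybar u v"])
      show "((\<lambda>y. \<mu> \<bullet> h y) has_derivative (\<lambda>u. \<mu> \<bullet> h1 y u)) (at y)" if "y \<in> V" for y
        by (intro has_derivative_inner_right h1 that)
      show "((\<lambda>y. \<mu> \<bullet> h1 y v) has_derivative (\<lambda>u. \<mu> \<bullet> h2 ybar u v)) (at ybar)"
        by (intro has_derivative_inner_right
            bounded_linear.has_derivative[OF blinfun.bounded_linear_left] h2 reduc(2))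
    qed (use reduc in auto)
    ultimately show ?thesis
      by (simp add: R.Q_def F2_eq D_def blinfun.add_left inner_add_right D1 adj
          mu_of_adjoint[OF h1[OF reduc(2)] surj])
  qed
  have ne: "R.mults \<noteq> {}" using stationary mult by auto
  have iv: "(\<exists>lam\<in>multipliers g q \<Theta> xbar. D2 (\<lambda>x. g x + lam \<bullet> q x) xbar w w
      + D2 (\<lambda>y. mu_of h ybar lam \<bullet> h y) ybar (D1 q xbar w) (D1 q xbar w) \<ge> 0)
    \<longleftrightarrow> (\<exists>\<mu>\<in>R.mults. R.Q \<mu> w \<ge> 0)" for w
    by (simp add: mult val)
  show ?thesis
    unfolding Let_def iv D1(1)
  proof (intro conjI impI iffI ballI)
    fix w z assume "\<exists>\<delta>>0. \<forall>x\<in>\<Gamma>. dist x xbar < \<delta> \<longrightarrow> g xbar \<le> g x"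
      and "z \<in> graph_deriv (limiting_subdiff (fobj g \<Gamma>)) xbar 0 w"
    then show "z \<bullet> w \<ge> 0" using R.graph_deriv_nonneg_if_local_min by blast
  next
    fix w assume "\<forall>w\<in>graph_deriv_dom (limiting_subdiff (fobj g \<Gamma>)) xbar 0.
        \<forall>z\<in>graph_deriv (limiting_subdiff (fobj g \<Gamma>)) xbar 0 w. z \<bullet> w \<ge> 0"
      and "w \<in> graph_deriv_dom (limiting_subdiff (fobj g \<Gamma>)) xbar 0"
    then show "\<exists>z\<in>graph_deriv (limiting_subdiff (fobj g \<Gamma>)) xbar 0 w. z \<bullet> w \<ge> 0"
      by (auto simp: graph_deriv_dom_def)
  next
    \<comment> \<open>The passage from (iii) to (ii) goes through (iv).\<close>
    fix w z assume iii: "\<forall>w\<in>graph_deriv_dom (limiting_subdiff (fobj g \<Gamma>)) xbar 0.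
        \<exists>z\<in>graph_deriv (limiting_subdiff (fobj g \<Gamma>)) xbar 0 w. z \<bullet> w \<ge> 0"
      and z: "z \<in> graph_deriv (limiting_subdiff (fobj g \<Gamma>)) xbar 0 w"
    show "z \<bullet> w \<ge> 0"
      using R.graph_deriv_nonneg_if_second_order[OF z R.second_order_if_graph_deriv[OF _ _ ne]] iii by blast
  next
    fix w assume "\<forall>w\<in>graph_deriv_dom (limiting_subdiff (fobj g \<Gamma>)) xbar 0.
        \<exists>z\<in>graph_deriv (limiting_subdiff (fobj g \<Gamma>)) xbar 0 w. z \<bullet> w \<ge> 0"
      and "w \<in> tangent_cone \<Gamma> xbar \<inter> {w. g1 xbar w = 0}"
    then show "\<exists>\<mu>\<in>R.mults. R.Q \<mu> w \<ge> 0" using R.second_order_if_graph_deriv[OF _ _ ne, of w] by blast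
  next
    fix w assume iv: "\<forall>w\<in>tangent_cone \<Gamma> xbar \<inter> {w. g1 xbar w = 0}. \<exists>\<mu>\<in>R.mults. R.Q \<mu> w \<ge> 0"
      and "w \<in> graph_deriv_dom (limiting_subdiff (fobj g \<Gamma>)) xbar 0"
    then obtain z where z: "z \<in> graph_deriv (limiting_subdiff (fobj g \<Gamma>)) xbar 0 w"
      by (auto simp: graph_deriv_dom_def)
    show "\<exists>z\<in>graph_deriv (limiting_subdiff (fobj g \<Gamma>)) xbar 0 w. z \<bullet> w \<ge> 0"
      using R.graph_deriv_nonneg_if_second_order[OF z] iv z by blast
  qed
qed

end
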